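(* Let $E$ be a Banach lattice, let $\mu$ be a locally finite Borel measure on $\mathbb{R}^d$ such that $\mu(\mathbb{R}^d)=\infty$, and let $r\in(1,\infty)$. Assume that there is a constant $C_{E,r}$ (independent of the collection $\mathcal{D}$ and the function $f$) such that for each finite collection $\mathcal{D}$ of dyadic cubes in $\mathbb{R}^d$ and for each locally integrable function $f:\mathbb{R}^d\to E$ there exists a sparse collection $\mathcal{S}\subseteq\mathcal{D}$ such that $$ \bigl\|\widetilde{M}^\mu_{\mathcal{D}}f(x)\bigr\|_E \leq C_{E,r}\,\mathcal{A}^\mu_{r,\mathcal{S}}(\|f\|_E)(x)\qquad\text{for }\mu\text{-a.e. }x\in\mathbb{R}^d. $$ Then the Banach lattice $E$ is $q$-convex for all exponents $q\in[1,r)$.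
   Context: Dyadic cubes are the cubes of the standard dyadic system on $\mathbb{R}^d$, i.e. $2^{-k}([0,1)^d+m)$ with $k\in\mathbb{Z}$, $m\in\mathbb{Z}^d$. Local integrability of $f:\mathbb{R}^d\to E$ is with respect to $\mu$, in the Bochner sense; $\|f\|_E$ denotes the scalar function $x\mapsto\|f(x)\|_E$. For a cube $Q$, $\langle f\rangle^\mu_Q:=\frac{1}{\mu(Q)}\int_Q f\,\mathrm{d}\mu$ (cubes of $\mu$-measure zero are irrelevant for the $\mu$-a.e. statement; take the average to be $0$ there). Dyadic lattice Hardy--Littlewood maximal operator: for a finite collection $\mathcal{D}$ of dyadic cubes and locally integrable $f:\mathbb{R}^d\to E$, $$\widetilde{M}^\mu_{\mathcal{D}}f(x):=\sup_{Q\in\mathcal{D}}\langle|f|\rangle^\mu_Q\mathbf{1}_Q(x),\qquad x\in\mathbb{R}^d,$$ where the supremum and the absolute value are taken in the lattice sense in $E$. Sparse collection: a subcollection $\mathcal{S}\subseteq\mathcal{D}$ is sparse (with respect to $\mu$) if for every $S\in\mathcal{S}$ there is a measurable subset $E_S\subseteq S$ with $\mu(E_S)\geq\frac12\mu(S)$ such that the sets $\{E_S\}_{S\in\mathcal{S}}$ are pairwise disjoint. Sparse operator: for $q\in[1,\infty)$, a sparse collection $\mathcal{S}$ of dyadic cubes and locally integrable $g:\mathbb{R}^d\to\mathbb{R}$, $$\mathcal{A}^\mu_{q,\mathcal{S}}g(x):=\Bigl(\sum_{S\in\mathcal{S}}\bigl(\langle|g|\rangle^\mu_S\bigr)^q\mathbf{1}_S(x)\Bigr)^{1/q}.$$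 $q$-convexity: a Banach lattice $E$ is $q$-convex, $q\in[1,\infty)$, if there is a constant $C_{E,q}$ such that $$\Bigl\|\Bigl(\sum_{k=1}^n|e_k|^q\Bigr)^{1/q}\Bigr\|_E\leq C_{E,q}\Bigl(\sum_{k=1}^n\|e_k\|_E^q\Bigr)^{1/q}$$ for all $n\in\mathbb{N}$ and $e_1,\dots,e_n\in E$, where $\bigl(\sum_k|e_k|^q\bigr)^{1/q}$ is defined by the Krivine functional calculus (pointwise in a Banach function space). *)

theory Defs
  imports "HOL-Analysis.Analysis" "HOL-Library.Lattice_Algebras"
begin

section \<open>Banach lattices\<close>

text \<open>
  Real Banach lattices. The class \<^class>\<open>lattice_ab_group_add_abs\<close> provides
  \<open>\<bar>x\<bar> = sup x (- x)\<close>.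
\<close>

class banach_lattice = banach + ordered_real_vector + lattice_ab_group_add_abs +
  assumes norm_mono_abs: "\<bar>x\<bar> \<le> \<bar>y\<bar> \<Longrightarrow> norm x \<le> norm y"

section \<open>Bochner integration without separability\<close>

text \<open>
  The library integral \<^const>\<open>lebesgue_integral\<close> is only available for second countable
  (i.e. separable) range spaces and for functions that are Borel measurable rather than strongly
  measurable up to a null set. An arbitrary Banach lattice need not be separable, so the textbook
  definition is stated here for all normed spaces, on top of the library's integral of simple
  functions. Replacing \<open>f\<close> on a null set changes nothing (see \<open>nn_integral_cong_AE\<close>), so it does not matter that
  \<open>norm (f x - s i x)\<close> is measurable only up to a null set. Strong measurability must be
  required separately, as \<^const>\<open>nn_integral\<close> is a lower integral on nonmeasurable functions.
\<close>

definition strongly_measurable :: "'a measure \<Rightarrow> ('a \<Rightarrow> 'b::real_normed_vector) \<Rightarrow> bool" where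
  "strongly_measurable M f \<longleftrightarrow>
    (\<exists>s. (\<forall>i::nat. Bochner_Integration.simple_bochner_integrable M (s i)) \<and>
         (AE x in M. (\<lambda>i. s i x) \<longlonglongrightarrow> f x))"

definition has_strong_integral ::
    "'a measure \<Rightarrow> ('a \<Rightarrow> 'b::real_normed_vector) \<Rightarrow> 'b \<Rightarrow> bool" where
  "has_strong_integral M f y \<longleftrightarrow>
    strongly_measurable M f \<and>
    (\<exists>s. (\<forall>i::nat. Bochner_Integration.simple_bochner_integrable M (s i)) \<and>
         (\<lambda>i. \<integral>\<^sup>+x. ennreal (norm (f x - s i x)) \<partial>M) \<longlonglongrightarrow> 0 \<and>
         (\<lambda>i. Bochner_Integration.simple_bochner_integral M (s i)) \<longlonglongrightarrow> y)"

text \<open>On the common domain, the integral coincides with the one of the library.\<close>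

lemma has_bochner_integral_imp_has_strong_integral:
  fixes f :: "'a \<Rightarrow> 'b::{banach, second_countable_topology}"
  assumes "has_bochner_integral M f y"
  shows "has_strong_integral M f y"
  using assms
proof cases
  case (1 s)
  have int_s: "integrable M (s i)" for i
    using has_bochner_integral_simple_bochner_integrable[OF 1(2)] by (rule integrable.intros)
  have int: "integrable M (\<lambda>x. f x - s i x)" for i
    using integrable.intros[OF assms] int_s by auto
  have "(\<lambda>i. ennreal (\<integral>x. norm (f x - s i x) \<partial>M)) \<longlonglongrightarrow> ennreal 0"
    using 1(3) int by (subst (asm) nn_integral_eq_integral) auto
  then have "(\<lambda>i. \<integral>x. norm (f x - s i x) \<partial>M) \<longlonglongrightarrow> 0"
    by (subst (asm) tendsto_ennreal_iff) auto
  then obtain r where r: "strict_mono r" "AE x in M. (\<lambda>i. f x - s (r i) x) \<longlonglongrightarrow> 0"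
    using tendsto_L1_AE_subseq[of M "\<lambda>i x. f x - s i x"] int by auto
  have "AE x in M. (\<lambda>i. s (r i) x) \<longlonglongrightarrow> f x"
    using r(2)
  proof eventually_elim
    case (elim x)
    from tendsto_diff[OF tendsto_const[of "f x"] this] show ?case by simp
  qed
  then show ?thesis
    using 1 unfolding has_strong_integral_def strongly_measurable_def
    by (intro conjI exI[of _ s] exI[of _ "\<lambda>i. s (r i)"]) auto
qed

definition strongly_integrable :: "'a measure \<Rightarrow> ('a \<Rightarrow> 'b::real_normed_vector) \<Rightarrow> bool" where
  "strongly_integrable M f \<longleftrightarrow> (\<exists>y. has_strong_integral M f y)"

definition strong_integral :: "'a measure \<Rightarrow> ('a \<Rightarrow> 'b::real_normed_vector) \<Rightarrow> 'b" where
  "strong_integral M f = (THE y. has_strong_integral M f y)"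

definition locally_integrable ::
    "'a::topological_space measure \<Rightarrow> ('a \<Rightarrow> 'b::real_normed_vector) \<Rightarrow> bool" where
  "locally_integrable M f \<longleftrightarrow>
    (\<forall>K. compact K \<longrightarrow> strongly_integrable M (\<lambda>x. indicator K x *\<^sub>R f x))"

definition locally_finite_borel_measure :: "'a::topological_space measure \<Rightarrow> bool" where
  "locally_finite_borel_measure M \<longleftrightarrow>
    sets M = sets borel \<and> (\<forall>x. \<exists>U. open U \<and> x \<in> U \<and> emeasure M U < \<infinity>)"

text \<open>Division by zero makes the average vanish on sets of measure zero.\<close>

definition average :: "'a measure \<Rightarrow> 'a set \<Rightarrow> ('a \<Rightarrow> 'b::real_normed_vector) \<Rightarrow> 'b" where
  "average M Q f = (1 / measure M Q) *\<^sub>R strong_integral M (\<lambda>x. indicator Q x *\<^sub>R f x)"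

section \<open>Dyadic cubes, maximal operator, sparse operators\<close>

definition dyadic_cube :: "int \<Rightarrow> ('d \<Rightarrow> int) \<Rightarrow> (real ^ 'd) set" where
  "dyadic_cube k m =
    (\<lambda>y. (2 powi (- k)) *\<^sub>R (y + (\<chi> i. of_int (m i)))) ` {y. \<forall>i. 0 \<le> y $ i \<and> y $ i < 1}"

definition dyadic_cubes :: "(real ^ 'd) set set" where
  "dyadic_cubes = {dyadic_cube k m | k m. True}"

text \<open>
  The supremum is the one of the lattice \<open>'e\<close>, which exists for finite nonempty collections; the
  supremum over the empty collection (of elements of the positive cone) is \<open>0\<close>.
\<close>

definition lattice_maximal ::
    "'a measure \<Rightarrow> 'a set set \<Rightarrow> ('a \<Rightarrow> 'e::banach_lattice) \<Rightarrow> 'a \<Rightarrow> 'e" where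
  "lattice_maximal M \<D> f x =
    (if \<D> = {} then 0
     else Sup_fin ((\<lambda>Q. indicator Q x *\<^sub>R average M Q (\<lambda>y. \<bar>f y\<bar>)) ` \<D>))"

definition sparse_collection :: "'a measure \<Rightarrow> 'a set set \<Rightarrow> bool" where
  "sparse_collection M \<S> \<longleftrightarrow>
    (\<exists>F. (\<forall>S\<in>\<S>. F S \<in> sets M \<and> F S \<subseteq> S \<and> emeasure M S / 2 \<le> emeasure M (F S)) \<and>
         disjoint_family_on F \<S>)"

text \<open>
  Only meaningful for finite \<open>\<S>\<close>, since \<^const>\<open>sum\<close> is \<open>0\<close> on infinite sets.
\<close>

definition sparse_operator ::
    "'a measure \<Rightarrow> real \<Rightarrow> 'a set set \<Rightarrow> ('a \<Rightarrow> real) \<Rightarrow> 'a \<Rightarrow> real" where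
  "sparse_operator M q \<S> g x =
    (\<Sum>S\<in>\<S>. average M S (\<lambda>y. \<bar>g y\<bar>) powr q * indicator S x) powr (1 / q)"

section \<open>Krivine functional calculus and convexity\<close>

text \<open>
  The continuous positively homogeneous functions on \<open>n\<close>-dimensional real space. As \<open>n\<close> varies,
  these are represented as functions on sequences that depend only on the first \<open>n\<close> coordinates;
  for such functions, continuity in the product topology is continuity on \<open>n\<close>-dimensional space.
\<close>

definition pos_hom_functions :: "nat \<Rightarrow> ((nat \<Rightarrow> real) \<Rightarrow> real) set" where
  "pos_hom_functions n =
    {h. continuous_on UNIV h \<and>
        (\<forall>a b. (\<forall>k<n. a k = b k) \<longrightarrow> h a = h b) \<and>
        (\<forall>c a. 0 \<le> c \<longrightarrow> h (\<lambda>k. c * a k) = c * h a)}"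

definition krivine_hom ::
    "nat \<Rightarrow> (nat \<Rightarrow> 'e::banach_lattice) \<Rightarrow> (((nat \<Rightarrow> real) \<Rightarrow> real) \<Rightarrow> 'e) \<Rightarrow> bool" where
  "krivine_hom n e \<Phi> \<longleftrightarrow>
    (\<forall>k<n. \<Phi> (\<lambda>a. a k) = e k) \<and>
    (\<forall>g\<in>pos_hom_functions n. \<forall>c. \<Phi> (\<lambda>a. c * g a) = c *\<^sub>R \<Phi> g) \<and>
    (\<forall>g\<in>pos_hom_functions n. \<forall>h\<in>pos_hom_functions n.
       \<Phi> (\<lambda>a. g a + h a) = \<Phi> g + \<Phi> h \<and>
       \<Phi> (\<lambda>a. max (g a) (h a)) = sup (\<Phi> g) (\<Phi> h) \<and>
       \<Phi> (\<lambda>a. min (g a) (h a)) = inf (\<Phi> g) (\<Phi> h))"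

text \<open>
  By Krivine's theorem, a homomorphism as above exists and its values on
  \<^term>\<open>pos_hom_functions n\<close> are uniquely determined; \<open>krivine n e h\<close> is the element usually
  written \<open>h(e\<^sub>0, \<dots>, e\<^sub>n\<^sub>-\<^sub>1)\<close>.
\<close>

definition krivine ::
    "nat \<Rightarrow> (nat \<Rightarrow> 'e::banach_lattice) \<Rightarrow> ((nat \<Rightarrow> real) \<Rightarrow> real) \<Rightarrow> 'e" where
  "krivine n e = (SOME \<Phi>. krivine_hom n e \<Phi>)"

definition q_convex :: "'e::banach_lattice itself \<Rightarrow> real \<Rightarrow> bool" where
  "q_convex (_ :: 'e itself) q \<longleftrightarrow>
    (\<exists>C. \<forall>n. \<forall>e :: nat \<Rightarrow> 'e.
       norm (krivine n e (\<lambda>a. (\<Sum>k<n. \<bar>a k\<bar> powr q) powr (1 / q)))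
         \<le> C * (\<Sum>k<n. norm (e k) powr q) powr (1 / q))"

end

theory Submission
  imports Defs
begin

text \<open>
  Placing values \<open>y k \<ge> 0\<close> on the shells of very rapidly growing nested dyadic cubes turns the
  domination hypothesis into an upper \<open>r\<close>-estimate
  \<open>norm (sup\<^sub>k y k) \<le> C * (\<Sum>k. norm (y k) powr r) powr (1 / r)\<close>.
  For \<open>1 < q < r\<close>, let \<open>\<xi> k\<close> be independent random variables with tails \<open>P(\<xi> k > t) = t powr (-q)\<close>.
  Then \<open>(\<Sum>k. \<bar>a k\<bar> powr q) powr (1 / q)\<close> is comparable to the expectation of \<open>max\<^sub>k \<xi> k * \<bar>a k\<bar>\<close>,
  and the expectation of \<open>(\<Sum>k. (\<xi> k * c k) powr r) powr (1 / r)\<close> is at most a constant times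
  \<open>(\<Sum>k. c k powr q) powr (1 / q)\<close> because \<open>q < r\<close>. Applying the upper estimate to \<open>\<xi> k *\<^sub>R \<bar>e k\<bar>\<close>
  and averaging gives \<open>q\<close>-convexity; a finite discretization of \<open>\<xi>\<close> suffices.

  Krivine's functional calculus is constructed without representation theorems: a lattice-linear
  expression is a join of meets of linear forms, so by Gordan's alternative an expression that is
  nonpositive on all real vectors is nonpositive in every vector lattice; these expressions are dense
  in the positively homogeneous continuous functions.
\<close>

section \<open>Vector lattices and Gordan's alternative\<close>

text \<open>Distributivity comes from the group identity \<open>a + z = inf a z + sup a z\<close>.
  Solving for \<open>z\<close> turns a bound on \<open>inf a z\<close> into one on \<open>z\<close>
  itself; such bounds pass from \<open>b\<close> and \<open>c\<close> to their join.\<close>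

lemma inf_sup_distrib_group:
  fixes a b c :: "'e::lattice_ab_group_add"
  shows "inf a (sup b c) = sup (inf a b) (inf a c)"
proof (rule antisym)
  let ?u = "sup (inf a b) (inf a c)" and ?s = "sup a (sup b c)"
  have *: "z \<le> ?s + ?u - a" if "z \<le> sup b c" "inf a z \<le> ?u" for z
  proof -
    have "z = sup a z + inf a z - a"
      using add_eq_inf_sup[of a z] by (simp add: algebra_simps)
    also have "\<dots> \<le> ?s + ?u - a"
      using that by (intro diff_right_mono add_mono sup_mono) auto
    finally show ?thesis .
  qed
  have "sup b c \<le> ?s + ?u - a"
    by (intro sup_least *) auto
  moreover have "inf a (sup b c) = a + sup b c - ?s"
    using add_eq_inf_sup[of a "sup b c"] by (simp add: eq_diff_eq del: diff_sup_eq_inf)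
  ultimately show "inf a (sup b c) \<le> ?u"
    by (metis add.commute diff_le_eq le_diff_eq)
qed (auto intro: le_infI2)

section \<open>Compatibility of lattice operations with scalars and the norm\<close>

lemma scaleR_sup:
  fixes x y :: "'e::banach_lattice"
  assumes "0 \<le> c"
  shows "c *\<^sub>R sup x y = sup (c *\<^sub>R x) (c *\<^sub>R y)"
proof (cases "c = 0")
  case False
  with assms have c: "c > 0" by simp
  show ?thesis
  proof (rule antisym)
    have "sup x y \<le> inverse c *\<^sub>R sup (c *\<^sub>R x) (c *\<^sub>R y)"
      using c by (intro sup_least) (auto simp: pos_le_divideR_eq)
    from scaleR_left_mono[OF this, of c] show "c *\<^sub>R sup x y \<le> sup (c *\<^sub>R x) (c *\<^sub>R y)"
      using c by simp
  qed (use c in \<open>auto intro!: scaleR_left_mono\<close>)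
qed simp

lemma scaleR_inf:
  fixes x y :: "'e::banach_lattice"
  assumes "0 \<le> c"
  shows "c *\<^sub>R inf x y = inf (c *\<^sub>R x) (c *\<^sub>R y)"
  using scaleR_sup[OF assms, of "- x" "- y"]
  by (simp add: inf_eq_neg_sup[of x] inf_eq_neg_sup[of "c *\<^sub>R x"] del: neg_sup_eq_inf)

text \<open>Adding both absolute differences to \<open>sup c d\<close> gives an upper bound of
  \<open>a\<close> and of \<open>b\<close>, hence of their join; then the roles are exchanged. The
  norm versions below supply the Lipschitz bounds for the functional calculus.\<close>

lemma abs_sup_diff_le:
  fixes a b c d :: "'e::lattice_ab_group_add_abs"
  shows "\<bar>sup a b - sup c d\<bar> \<le> \<bar>a - c\<bar> + \<bar>b - d\<bar>"
proof -
  have *: "sup a b - sup c d \<le> \<bar>a - c\<bar> + \<bar>b - d\<bar>" for a b c d :: 'e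
  proof -
    have le: "x \<le> \<bar>x\<bar> + \<bar>y\<bar>" for x y :: 'e
      using add_mono[OF abs_ge_self[of x] abs_ge_zero[of y]] by (simp only: add_0_right)
    have 1: "a - c \<le> \<bar>a - c\<bar> + \<bar>b - d\<bar>"
      by (rule le)
    have 2: "b - d \<le> \<bar>a - c\<bar> + \<bar>b - d\<bar>"
      using le[of "b - d" "a - c"] by (subst add.commute)
    have "a \<le> \<bar>a - c\<bar> + \<bar>b - d\<bar> + sup c d"
      using add_mono[OF 1 sup_ge1[of c d]] by (simp only: diff_add_cancel)
    moreover have "b \<le> \<bar>a - c\<bar> + \<bar>b - d\<bar> + sup c d"
      using add_mono[OF 2 sup_ge2[of d c]] by (simp only: diff_add_cancel)
    ultimately show ?thesis
      unfolding diff_le_eq by (rule sup_least)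
  qed
  show ?thesis
  proof (rule abs_leI[OF *])
    show "- (sup a b - sup c d) \<le> \<bar>a - c\<bar> + \<bar>b - d\<bar>"
      using *[of c d a b] by (simp only: minus_diff_eq abs_minus_commute[of c a] abs_minus_commute[of d b])
  qed
qed

lemma norm_sup_diff_le:
  fixes a b c d :: "'e::banach_lattice"
  shows "norm (sup a b - sup c d) \<le> norm (a - c) + norm (b - d)"
proof -
  have "norm (sup a b - sup c d) \<le> norm (\<bar>a - c\<bar> + \<bar>b - d\<bar>)"
    using abs_sup_diff_le[of a b c d] by (intro norm_mono_abs) simp
  also have "\<dots> \<le> norm (a - c) + norm (b - d)"
    using norm_triangle_ineq[of "\<bar>a - c\<bar>" "\<bar>b - d\<bar>"] norm_mono_abs[of "\<bar>a - c\<bar>" "a - c"]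
      norm_mono_abs[of "\<bar>b - d\<bar>" "b - d"] by simp
  finally show ?thesis .
qed

lemma norm_inf_diff_le:
  fixes a b c d :: "'e::banach_lattice"
  shows "norm (inf a b - inf c d) \<le> norm (a - c) + norm (b - d)"
proof -
  have 1: "inf a b - inf c d = sup (- c) (- d) - sup (- a) (- b)"
    by (simp only: inf_eq_neg_sup[of a b] inf_eq_neg_sup[of c d] diff_minus_eq_add uminus_add_conv_diff)
  have 2: "norm (- c - - a) = norm (a - c)" "norm (- d - - b) = norm (b - d)"
    by (simp_all only: diff_minus_eq_add uminus_add_conv_diff)
  show ?thesis
    using norm_sup_diff_le[of "- c" "- d" "- a" "- b"] unfolding 1 2 .
qed

lemma norm_abs_lattice [simp]: "norm \<bar>x\<bar> = norm x" for x :: "'e::banach_lattice"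
  by (rule antisym; rule norm_mono_abs) (simp_all only: abs_idempotent order_refl)

lemma norm_mono_nonneg: "norm x \<le> norm y" if "0 \<le> x" "x \<le> y" for x y :: "'e::banach_lattice"
proof (rule norm_mono_abs)
  have "0 \<le> y" using that by (rule order_trans)
  then show "\<bar>x\<bar> \<le> \<bar>y\<bar>"
    using that by (simp only: abs_of_nonneg)
qed

section \<open>Compactness in products and Gordan's alternative\<close>

lemma compact_Pi_UNIV:
  fixes K :: "'i \<Rightarrow> 'a::topological_space set"
  assumes "\<And>i. compact (K i)"
  shows "compact {f. \<forall>i. f i \<in> K i}"
proof -
  have "compactin (product_topology (\<lambda>i. euclidean) UNIV) (PiE UNIV K)"
    using assms by (simp add: compactin_PiE)
  then show ?thesis
    by (simp add: euclidean_product_topology PiE_UNIV_domain Pi_def)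
qed

text \<open>Elements of \<open>L\<close> are coefficient vectors. The shortest vector
  \<open>a\<close> in their convex hull, measured on the first \<open>n\<close> coordinates, must
  vanish: otherwise some \<open>l\<close> in \<open>L\<close> has nonpositive inner product with
  \<open>a\<close>, and a move from \<open>a\<close> towards \<open>l\<close> shortens it.\<close>

lemma gordan:
  fixes L :: "(nat \<Rightarrow> real) set"
  assumes fin: "finite L" and ne: "L \<noteq> {}"
    and nonpos: "\<And>a. \<exists>l\<in>L. (\<Sum>k<n. l k * a k) \<le> 0"
  obtains w where "\<And>l. l \<in> L \<Longrightarrow> 0 \<le> w l" "(\<Sum>l\<in>L. w l) = (1::real)"
    "\<And>k. k < n \<Longrightarrow> (\<Sum>l\<in>L. w l * l k) = 0"
proof -
  \<comment> \<open>Weights are functions on all sequences that vanish off \<open>L\<close>; this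
    makes \<open>W\<close> a closed subset of a product of compact sets.\<close>
  define W where "W = {w :: (nat \<Rightarrow> real) \<Rightarrow> real. (\<forall>l. w l \<in> (if l \<in> L then {0..1} else {0}))} \<inter>
    {w. (\<Sum>l\<in>L. w l) = 1}"
  define Q where "Q w = (\<Sum>k<n. (\<Sum>l\<in>L. w l * l k)\<^sup>2)" for w :: "(nat \<Rightarrow> real) \<Rightarrow> real"
  have cont: "continuous_on UNIV Q" "continuous_on UNIV (\<lambda>w :: (nat \<Rightarrow> real) \<Rightarrow> real. \<Sum>l\<in>L. w l)"
    unfolding Q_def by (intro continuous_intros continuous_on_product_coordinates)+
  have "compact W"
    unfolding W_def
    by (intro compact_Int_closed compact_Pi_UNIV closed_Collect_eq cont(2) continuous_on_const) auto
  moreover obtain l0 where l0: "l0 \<in> L" using ne by auto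
  have "(\<lambda>l. if l = l0 then 1 else 0) \<in> W"
    using l0 fin by (auto simp: W_def)
  then have "W \<noteq> {}" by auto
  ultimately obtain w where w: "w \<in> W" and min: "\<And>v. v \<in> W \<Longrightarrow> Q w \<le> Q v"
    using continuous_attains_inf[of W Q] continuous_on_subset[OF cont(1)] by (metis subset_UNIV)
  define a where "a k = (\<Sum>l\<in>L. w l * l k)" for k
  define S where "S = (\<Sum>k<n. (a k)\<^sup>2)"
  have w01: "0 \<le> w l" "l \<in> L \<Longrightarrow> w l \<le> 1" "l \<notin> L \<Longrightarrow> w l = 0" for l
    using w unfolding W_def by (auto split: if_splits dest!: spec[of _ l])
  have w1: "(\<Sum>l\<in>L. w l) = 1" using w by (auto simp: W_def)
  have "S = 0"
  proof (rule ccontr)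
    assume "S \<noteq> 0"
    moreover have "S \<ge> 0" unfolding S_def by (intro sum_nonneg) auto
    ultimately have S: "S > 0" by simp
    obtain l where l: "l \<in> L" and le: "(\<Sum>k<n. l k * a k) \<le> 0" using nonpos by blast
    define R where "R = (\<Sum>k<n. (l k)\<^sup>2)"
    have R: "R \<ge> 0" unfolding R_def by (intro sum_nonneg) auto
    \<comment> \<open>This \<open>t\<close> minimizes
      \<open>(1 - t)\<^sup>2 * S + t\<^sup>2 * R\<close>, the bound left once the nonpositive cross
      term is dropped.\<close>
    define t where "t = S / (S + R)"
    have t: "0 < t" "t \<le> 1" using S R by (auto simp: t_def)
    define v where "v m = (1 - t) * w m + t * (if m = l then 1 else 0)" for m
    have sumv: "(\<Sum>m\<in>L. v m * f m) = (1 - t) * (\<Sum>m\<in>L. w m * f m) + t * f l" for f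
    proof -
      have "(\<Sum>m\<in>L. v m * f m) = (\<Sum>m\<in>L. (1 - t) * (w m * f m) + (if m = l then t * f m else 0))"
        unfolding v_def by (intro sum.cong) (auto simp: algebra_simps)
      also have "\<dots> = (1 - t) * (\<Sum>m\<in>L. w m * f m) + t * f l"
        using fin l by (simp add: sum.distrib sum_distrib_left)
      finally show ?thesis .
    qed
    have v01: "0 \<le> v m" "m \<notin> L \<Longrightarrow> v m = 0" for m
      using w01[of m] t l by (auto simp: v_def)
    have v1: "(\<Sum>m\<in>L. v m) = 1" using sumv[of "\<lambda>_. 1"] w1 by simp
    have "v m \<le> 1" if "m \<in> L" for m
      using member_le_sum[of m L v] v01 that fin v1 by auto
    then have "v \<in> W" using v01 v1 by (auto simp: W_def)
    then have "Q w \<le> Q v" by (rule min)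
    then have "S \<le> (\<Sum>k<n. ((1 - t) * a k + t * l k)\<^sup>2)"
      by (simp add: Q_def S_def a_def sumv)
    also have "\<dots> = (1 - t)\<^sup>2 * S + 2 * t * (1 - t) * (\<Sum>k<n. l k * a k) + t\<^sup>2 * R"
      unfolding S_def R_def sum_distrib_left sum.distrib[symmetric]
      by (intro sum.cong) (auto simp: power2_eq_square algebra_simps)
    also have "\<dots> \<le> (1 - t)\<^sup>2 * S + t\<^sup>2 * R"
      using mult_nonneg_nonpos[OF _ le, of "2 * t * (1 - t)"] t by simp
    finally have "t * (2 * S) \<le> t * (t * (S + R))"
      by (simp add: power2_eq_square algebra_simps)
    moreover have "t * (S + R) = S" using S R by (simp add: t_def)
    ultimately show False using t S by simp
  qed
  then have "a k = 0" if "k < n" for k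
    using that unfolding S_def by (subst (asm) sum_nonneg_eq_0_iff) auto
  with w01 w1 show ?thesis by (intro that[of w]) (auto simp: a_def)
qed

section \<open>Lattice-linear expressions\<close>

text \<open>
  \<open>lattice_term n e h x\<close>: one and the same lattice-linear expression in \<open>n\<close> variables takes the
  value \<open>h a\<close> at the real vector \<open>a\<close> and the value \<open>x\<close> at \<open>e\<close>.
\<close>

inductive lattice_term ::
    "nat \<Rightarrow> (nat \<Rightarrow> 'e::banach_lattice) \<Rightarrow> ((nat \<Rightarrow> real) \<Rightarrow> real) \<Rightarrow> 'e \<Rightarrow> bool"
  for n e where
  linear: "lattice_term n e (\<lambda>a. \<Sum>k<n. c k * a k) (\<Sum>k<n. c k *\<^sub>R e k)"
| sup: "lattice_term n e g x \<Longrightarrow> lattice_term n e h y \<Longrightarrow>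
    lattice_term n e (\<lambda>a. max (g a) (h a)) (sup x y)"
| inf: "lattice_term n e g x \<Longrightarrow> lattice_term n e h y \<Longrightarrow>
    lattice_term n e (\<lambda>a. min (g a) (h a)) (inf x y)"

inductive meet_term ::
    "nat \<Rightarrow> (nat \<Rightarrow> 'e::banach_lattice) \<Rightarrow> ((nat \<Rightarrow> real) \<Rightarrow> real) \<Rightarrow> 'e \<Rightarrow> bool"
  for n e where
  linear: "meet_term n e (\<lambda>a. \<Sum>k<n. c k * a k) (\<Sum>k<n. c k *\<^sub>R e k)"
| inf: "meet_term n e g x \<Longrightarrow> meet_term n e h y \<Longrightarrow>
    meet_term n e (\<lambda>a. min (g a) (h a)) (inf x y)"

inductive join_term ::
    "nat \<Rightarrow> (nat \<Rightarrow> 'e::banach_lattice) \<Rightarrow> ((nat \<Rightarrow> real) \<Rightarrow> real) \<Rightarrow> 'e \<Rightarrow> bool"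
  for n e where
  meet: "meet_term n e g x \<Longrightarrow> join_term n e g x"
| sup: "join_term n e g x \<Longrightarrow> join_term n e h y \<Longrightarrow>
    join_term n e (\<lambda>a. max (g a) (h a)) (sup x y)"

text \<open>\<open>L\<close> collects the linear forms of the meet. At every real vector one of them
  is nonpositive, so Gordan's alternative gives a convex combination that vanishes identically;
  \<open>x\<close> lies below the same combination evaluated at \<open>e\<close>, which is
  0.\<close>

lemma meet_term_nonpos:
  assumes "meet_term n e h x" "\<And>a. h a \<le> 0"
  shows "x \<le> 0"
proof -
  have "\<exists>L. finite L \<and> L \<noteq> {} \<and> (\<forall>l\<in>L. x \<le> (\<Sum>k<n. l k *\<^sub>R e k)) \<and>
      (\<forall>a. \<exists>l\<in>L. (\<Sum>k<n. l k * a k) \<le> h a)"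
    using assms(1)
  proof induction
    case (linear c)
    then show ?case by (intro exI[of _ "{c}"]) auto
  next
    case (inf g x h y)
    then obtain L M where
      L: "finite L" "L \<noteq> {}" "\<forall>l\<in>L. x \<le> (\<Sum>k<n. l k *\<^sub>R e k)" "\<forall>a. \<exists>l\<in>L. (\<Sum>k<n. l k * a k) \<le> g a" and
      M: "finite M" "M \<noteq> {}" "\<forall>l\<in>M. y \<le> (\<Sum>k<n. l k *\<^sub>R e k)" "\<forall>a. \<exists>l\<in>M. (\<Sum>k<n. l k * a k) \<le> h a"
      by blast
    show ?case
    proof (intro exI[of _ "L \<union> M"] conjI allI ballI)
      fix a
      show "\<exists>l\<in>L \<union> M. (\<Sum>k<n. l k * a k) \<le> min (g a) (h a)"
        using L(4)[rule_format, of a] M(4)[rule_format, of a] by (cases "g a \<le> h a") (auto simp: min_def)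
    qed (use L M in \<open>auto intro: le_infI1 le_infI2\<close>)
  qed
  then obtain L where L: "finite L" "L \<noteq> {}" "\<And>l. l \<in> L \<Longrightarrow> x \<le> (\<Sum>k<n. l k *\<^sub>R e k)"
    and *: "\<And>a. \<exists>l\<in>L. (\<Sum>k<n. l k * a k) \<le> h a" by blast
  have "\<exists>l\<in>L. (\<Sum>k<n. l k * a k) \<le> 0" for a
    using *[of a] assms(2)[of a] by (meson order_trans)
  then obtain w where w: "\<And>l. l \<in> L \<Longrightarrow> 0 \<le> w l" "(\<Sum>l\<in>L. w l) = 1"
    "\<And>k. k < n \<Longrightarrow> (\<Sum>l\<in>L. w l * l k) = 0"
    using gordan[OF L(1,2), of n] by blast
  have "x = (\<Sum>l\<in>L. w l *\<^sub>R x)"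
    using w(2) by (simp add: scaleR_sum_left[symmetric])
  also have "\<dots> \<le> (\<Sum>l\<in>L. w l *\<^sub>R (\<Sum>k<n. l k *\<^sub>R e k))"
    by (intro sum_mono scaleR_left_mono L w)
  also have "\<dots> = (\<Sum>k<n. (\<Sum>l\<in>L. w l * l k) *\<^sub>R e k)"
    by (simp add: scaleR_sum_right scaleR_sum_left sum.swap[of _ L])
  also have "\<dots> = 0"
    by (simp add: w(3))
  finally show ?thesis .
qed

text \<open>Distributivity moves the meet inside the joins: induction on the left term, and once
  that is a plain meet, induction on the right term.\<close>

lemma join_term_inf:
  assumes "join_term n e g x" "join_term n e h y"
  shows "join_term n e (\<lambda>a. min (g a) (h a)) (inf x y)"
  using assms
proof induction
  case (meet g x)
  from meet(2,1) show ?case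
  proof induction
    case (meet h y)
    then show ?case by (intro join_term.meet meet_term.inf)
  next
    case (sup h1 y1 h2 y2)
    then have "join_term n e (\<lambda>a. max (min (g a) (h1 a)) (min (g a) (h2 a))) (sup (inf x y1) (inf x y2))"
      by (intro join_term.sup) auto
    then show ?case by (simp only: inf_sup_distrib_group min_max_distrib2)
  qed
next
  case (sup g1 x1 g2 x2)
  then have "join_term n e (\<lambda>a. max (min (g1 a) (h a)) (min (g2 a) (h a))) (sup (inf x1 y) (inf x2 y))"
    by (intro join_term.sup) auto
  then show ?case
    by (simp only: inf_sup_distrib_group inf_commute[of _ y] min_max_distrib1)
qed

lemma lattice_term_imp_join_term: "lattice_term n e h x \<Longrightarrow> join_term n e h x"
  by (induction rule: lattice_term.induct)
    (auto intro: join_term.intros meet_term.intros join_term_inf)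

text \<open>A join is nonpositive exactly when both its parts are, so the normal form reduces the
  claim to meets. This is what carries inequalities from real vectors to the Banach lattice.\<close>

lemma lattice_term_nonpos:
  assumes "lattice_term n e h x" "\<And>a. h a \<le> 0"
  shows "x \<le> 0"
  using lattice_term_imp_join_term[OF assms(1)] assms(2)
  by induction (auto intro: meet_term_nonpos)

section \<open>Closure of lattice terms under linear operations\<close>

lemma lattice_term_linear_add:
  assumes "lattice_term n e h y"
  shows "lattice_term n e (\<lambda>a. (\<Sum>k<n. c k * a k) + h a) ((\<Sum>k<n. c k *\<^sub>R e k) + y)"
  using assms
proof induction
  case (linear d)
  show ?case
    using lattice_term.linear[of n e "\<lambda>k. c k + d k"] by (simp add: algebra_simps sum.distrib)
next
  case (sup g x h y)
  then show ?case
    using lattice_term.sup by (fastforce simp only: add_sup_distrib_left max_add_distrib_right)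
next
  case (inf g x h y)
  then show ?case
    using lattice_term.inf by (fastforce simp only: add_inf_distrib_left min_add_distrib_right)
qed

text \<open>Sums are not constructors of \<open>lattice_term\<close>. Translations distribute over
  joins and meets, so induction on the left summand reduces to the linear case just treated.\<close>

lemma lattice_term_add:
  assumes "lattice_term n e g x" "lattice_term n e h y"
  shows "lattice_term n e (\<lambda>a. g a + h a) (x + y)"
  using assms
proof induction
  case (linear c)
  then show ?case by (rule lattice_term_linear_add)
next
  case (sup g x g' x')
  then have "lattice_term n e (\<lambda>a. max (g a + h a) (g' a + h a)) (sup (x + y) (x' + y))"
    by (intro lattice_term.sup)
  then show ?case by (simp only: add_sup_distrib_right max_add_distrib_left)
next
  case (inf g x g' x')
  then have "lattice_term n e (\<lambda>a. min (g a + h a) (g' a + h a)) (inf (x + y) (x' + y))"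
    by (intro lattice_term.inf)
  then show ?case by (simp only: add_inf_distrib_right min_add_distrib_left)
qed

lemma lattice_term_nonneg_scale:
  assumes "lattice_term n e h x" "0 \<le> t"
  shows "lattice_term n e (\<lambda>a. t * h a) (t *\<^sub>R x)"
  using assms(1)
proof induction
  case (linear c)
  show ?case
    using lattice_term.linear[of n e "\<lambda>k. t * c k"]
    by (simp add: sum_distrib_left scaleR_sum_right mult.assoc)
next
  case (sup g x h y)
  from lattice_term.sup[OF sup(3,4)] show ?case
    using assms(2) by (simp add: scaleR_sup max_mult_distrib_left)
next
  case (inf g x h y)
  from lattice_term.inf[OF inf(3,4)] show ?case
    using assms(2) by (simp add: scaleR_inf min_mult_distrib_left)
qed

lemma lattice_term_minus:
  assumes "lattice_term n e h x"
  shows "lattice_term n e (\<lambda>a. - h a) (- x)"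
  using assms
proof induction
  case (linear c)
  show ?case
    using lattice_term.linear[of n e "\<lambda>k. - c k"] by (simp add: sum_negf)
next
  case (sup g x h y)
  from lattice_term.inf[OF sup(3,4)] show ?case
    by (simp only: neg_sup_eq_inf minus_max_eq_min)
next
  case (inf g x h y)
  from lattice_term.sup[OF inf(3,4)] show ?case
    by (simp only: neg_inf_eq_sup minus_min_eq_max)
qed

lemma lattice_term_diff:
  assumes "lattice_term n e g x" "lattice_term n e h y"
  shows "lattice_term n e (\<lambda>a. g a - h a) (x - y)"
  using lattice_term_add[OF assms(1) lattice_term_minus[OF assms(2)]]
  by (simp only: add_uminus_conv_diff)

lemma lattice_term_scale:
  assumes "lattice_term n e h x"
  shows "lattice_term n e (\<lambda>a. t * h a) (t *\<^sub>R x)"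
  using lattice_term_nonneg_scale[OF assms, of t]
    lattice_term_minus[OF lattice_term_nonneg_scale[OF assms, of "- t"]]
  by (cases "0 \<le> t") simp_all

lemma lattice_term_abs:
  assumes "lattice_term n e h x"
  shows "lattice_term n e (\<lambda>a. \<bar>h a\<bar>) \<bar>x\<bar>"
proof -
  have "\<bar>h a\<bar> = max (h a) (- h a)" for a by auto
  then show ?thesis
    using lattice_term.sup[OF assms lattice_term_minus[OF assms]] by (simp only: abs_lattice)
qed

lemma lattice_term_zero: "lattice_term n e (\<lambda>a. 0) 0"
  using lattice_term.linear[of n e "\<lambda>_. 0"] by simp

lemma lattice_term_sum:
  assumes "finite I" "\<And>i. i \<in> I \<Longrightarrow> lattice_term n e (h i) (x i)"
  shows "lattice_term n e (\<lambda>a. \<Sum>i\<in>I. h i a) (\<Sum>i\<in>I. x i)"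
  using assms by (induction rule: finite_induct) (auto intro: lattice_term_zero lattice_term_add)

lemma lattice_term_Sup_fin:
  assumes "finite I" "I \<noteq> {}" "\<And>i. i \<in> I \<Longrightarrow> lattice_term n e (h i) (x i)"
  shows "lattice_term n e (\<lambda>a. Max ((\<lambda>i. h i a) ` I)) (Sup_fin (x ` I))"
  using assms
proof (induction rule: finite_ne_induct)
  case (insert i I)
  then show ?case by (auto intro!: lattice_term.sup)
qed simp

lemma lattice_term_coordinate:
  assumes "k < n"
  shows "lattice_term n e (\<lambda>a. a k) (e k)"
proof -
  have "lattice_term n e (\<lambda>a. \<Sum>j<n. (if j = k then 1 else 0) * a j)
      (\<Sum>j<n. (if j = k then 1 else 0) *\<^sub>R e j)"
    by (rule lattice_term.linear)
  moreover have "(\<Sum>j<n. (if j = k then 1 else 0) * a j) = a k" for a :: "nat \<Rightarrow> real"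
    using assms by (simp add: if_distrib[of "\<lambda>c. c * _"] cong: if_cong)
  moreover have "(\<Sum>j<n. (if j = k then 1 else 0) *\<^sub>R e j) = e k"
    using assms by (simp add: if_distrib[of "\<lambda>c. c *\<^sub>R _"] cong: if_cong)
  ultimately show ?thesis by simp
qed

section \<open>Transfer of inequalities from real vectors to the lattice\<close>

lemma lattice_term_le:
  assumes "lattice_term n e g x" "lattice_term n e h y" "\<And>a. g a \<le> h a"
  shows "x \<le> y"
  using lattice_term_nonpos[OF lattice_term_diff[OF assms(1,2)]] assms(3) by simp

lemma lattice_term_unit:
  "lattice_term n e (\<lambda>a. \<Sum>k<n. \<bar>a k\<bar>) (\<Sum>k<n. \<bar>e k\<bar>)"
  by (intro lattice_term_sum lattice_term_abs lattice_term_coordinate) auto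

text \<open>The l1-norm is itself a lattice term, with value
  \<open>\<Sum>k<n. \<bar>e k\<bar>\<close> at \<open>e\<close>, so closeness relative to it
  transfers to closeness in norm. Both uniqueness and convergence in the calculus below rest on
  this.\<close>

lemma lattice_term_norm_diff_le:
  assumes "lattice_term n e g x" "lattice_term n e h y"
    and "\<And>a. \<bar>g a - h a\<bar> \<le> \<epsilon> * (\<Sum>k<n. \<bar>a k\<bar>)"
  shows "norm (x - y) \<le> \<bar>\<epsilon>\<bar> * norm (\<Sum>k<n. \<bar>e k\<bar>)"
proof -
  have "\<bar>x - y\<bar> \<le> \<epsilon> *\<^sub>R (\<Sum>k<n. \<bar>e k\<bar>)"
    by (rule lattice_term_le[OF lattice_term_abs[OF lattice_term_diff[OF assms(1,2)]]
          lattice_term_scale[OF lattice_term_unit] assms(3)])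
  then have "norm \<bar>x - y\<bar> \<le> norm (\<epsilon> *\<^sub>R (\<Sum>k<n. \<bar>e k\<bar>))"
    by (intro norm_mono_nonneg) simp_all
  then show ?thesis by simp
qed

section \<open>Positively homogeneous functions and their approximation\<close>

lemma pos_hom_functions_linear: "(\<lambda>a. \<Sum>k<n. c k * a k) \<in> pos_hom_functions n"
  unfolding pos_hom_functions_def
  by (auto intro!: continuous_intros continuous_on_product_coordinates simp: sum_distrib_left algebra_simps)

lemma pos_hom_functions_max:
  assumes "g \<in> pos_hom_functions n" "h \<in> pos_hom_functions n"
  shows "(\<lambda>a. max (g a) (h a)) \<in> pos_hom_functions n"
  using assms unfolding pos_hom_functions_def
  by (auto intro!: continuous_intros simp: max_mult_distrib_left) metis+

lemma pos_hom_functions_min: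
  assumes "g \<in> pos_hom_functions n" "h \<in> pos_hom_functions n"
  shows "(\<lambda>a. min (g a) (h a)) \<in> pos_hom_functions n"
  using assms unfolding pos_hom_functions_def
  by (auto intro!: continuous_intros simp: min_mult_distrib_left) metis+

lemma lattice_term_pos_hom:
  "lattice_term n e h x \<Longrightarrow> h \<in> pos_hom_functions n"
  by (induction rule: lattice_term.induct)
    (auto intro: pos_hom_functions_linear pos_hom_functions_max pos_hom_functions_min)

lemma pos_hom_functions_continuous_on: "h \<in> pos_hom_functions n \<Longrightarrow> continuous_on A h"
  using continuous_on_subset[of UNIV h A] by (simp add: pos_hom_functions_def)

lemma pos_hom_functions_normalize:
  fixes a :: "nat \<Rightarrow> real"
  assumes "h \<in> pos_hom_functions n"
  defines "u \<equiv> \<Sum>k<n. \<bar>a k\<bar>"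
  shows "h a = u * h (\<lambda>k. if k < n then a k / u else 0)"
proof -
  have hom: "h (\<lambda>k. c * b k) = c * h b" if "0 \<le> c" for c b
    using assms(1) that by (simp add: pos_hom_functions_def)
  have dep: "h b = h b'" if "\<And>k. k < n \<Longrightarrow> b k = b' k" for b b'
    using assms(1) that by (simp add: pos_hom_functions_def)
  have u: "u \<ge> 0" unfolding u_def by (intro sum_nonneg) auto
  have "a k = u * (if k < n then a k / u else 0)" if "k < n" for k
    using that u by (cases "u = 0") (auto simp: u_def sum_nonneg_eq_0_iff)
  then have "h a = h (\<lambda>k. u * (if k < n then a k / u else 0))"
    by (rule dep)
  also have "\<dots> = u * h (\<lambda>k. if k < n then a k / u else 0)"
    by (rule hom[OF u])
  finally show ?thesis .
qed

lemma continuous_on_coordinate [continuous_intros]: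
  "continuous_on A (\<lambda>a::nat \<Rightarrow> real. a k)"
  using continuous_on_product_coordinates by (rule continuous_on_subset) simp

text \<open>
  On the sphere \<open>{a. (\<Sum>k<n. \<bar>a k\<bar>) = 1}\<close> the function \<open>h\<close> is approximated by a maximum of finitely
  many steep cones with apexes on the graph of \<open>h\<close>.
\<close>

lemma lattice_term_dense:
  fixes e :: "nat \<Rightarrow> 'e::banach_lattice"
  assumes h: "h \<in> pos_hom_functions n" and \<epsilon>: "0 < \<epsilon>"
  shows "\<exists>g x. lattice_term n e g x \<and> (\<forall>a. \<bar>h a - g a\<bar> \<le> \<epsilon> * (\<Sum>k<n. \<bar>a k\<bar>))"
proof -
  define u where "u a = (\<Sum>k<n. \<bar>a k\<bar>)" for a :: "nat \<Rightarrow> real"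
  define S where "S = {a. \<forall>k. a k \<in> (if k < n then {-1..1} else {0})} \<inter> {a. u a = 1}"
  have cont_u: "continuous_on A u" for A
    unfolding u_def by (intro continuous_intros)
  have cont: "continuous_on A h" for A
    using h by (rule pos_hom_functions_continuous_on)
  have comp: "compact S"
    unfolding S_def
    by (intro compact_Int_closed compact_Pi_UNIV closed_Collect_eq cont_u continuous_on_const) auto
  have S_I: "(\<lambda>k. if k < n then a k / u a else 0) \<in> S" if "u a \<noteq> 0" for a
  proof -
    have u: "u a > 0" using that unfolding u_def by (simp add: sum_nonneg less_le)
    have le: "\<bar>a k\<bar> \<le> u a" if "k < n" for k
      unfolding u_def using that by (intro member_le_sum) auto
    have "-1 \<le> a k / u a \<and> a k / u a \<le> 1" if "k < n" for k
      using le[OF that] u by (simp add: pos_le_divide_eq pos_divide_le_eq abs_le_iff)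
    moreover have "u (\<lambda>k. if k < n then a k / u a else 0) = u a / u a"
      using u unfolding u_def[of "\<lambda>k. if k < n then a k / u a else 0"]
      by (simp add: sum_divide_distrib[symmetric] u_def[of a, symmetric])
    ultimately show ?thesis
      unfolding S_def using u by simp
  qed
  obtain B where B: "\<And>a. a \<in> S \<Longrightarrow> \<bar>h a\<bar> \<le> B" "B \<ge> 0"
  proof -
    have "bounded (h ` S)"
      by (intro compact_imp_bounded compact_continuous_image cont comp)
    then obtain B where "\<forall>y\<in>h ` S. norm y \<le> B" unfolding bounded_iff by blast
    then show ?thesis by (intro that[of "max B 0"]) (auto simp: le_max_iff_disj)
  qed
  have cone: "\<exists>g x. lattice_term n e g x \<and> (\<forall>a\<in>S. g a \<le> h a + \<epsilon>) \<and> g p = h p" if p: "p \<in> S" for p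
  proof -
    \<comment> \<open>The factor \<open>u a\<close> keeps \<open>d\<close> homogeneous; on the
      sphere, where \<open>u a = 1\<close>, this is the l1-distance to the apex
      \<open>p\<close>.\<close>
    define d where "d a = (\<Sum>k<n. \<bar>a k - p k * u a\<bar>)" for a :: "nat \<Rightarrow> real"
    \<comment> \<open>Only on \<open>K\<close> does the apex height \<open>h p\<close> reach
      \<open>h a + \<epsilon>\<close>, so only there does the cone have to descend.\<close>
    define K where "K = S \<inter> {a. h a \<le> h p - \<epsilon>}"
    have cont_d: "continuous_on A d" for A
      unfolding d_def by (intro continuous_intros cont_u)
    have d_nonneg: "d a \<ge> 0" for a unfolding d_def by (intro sum_nonneg) auto
    have "compact K"
      unfolding K_def by (intro compact_Int_closed comp closed_Collect_le cont continuous_on_const)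
    have d_pos: "d a > 0" if a: "a \<in> K" for a
    proof (rule ccontr)
      assume "\<not> d a > 0"
      with d_nonneg[of a] have "d a = 0" by simp
      then have *: "a k = p k * u a" if "k < n" for k
        using that unfolding d_def by (subst (asm) sum_nonneg_eq_0_iff) auto
      have "a k = p k" for k
        using a p *[of k] unfolding K_def S_def by (cases "k < n") (auto dest!: spec[of _ k])
      then have "a = p" by auto
      with a \<epsilon> show False by (simp add: K_def)
    qed
    obtain \<delta> where \<delta>: "\<delta> > 0" "\<And>a. a \<in> K \<Longrightarrow> \<delta> \<le> d a"
    proof (cases "K = {}")
      case True
      then show ?thesis by (intro that[of 1]) auto
    next
      case False
      from continuous_attains_inf[OF \<open>compact K\<close> False cont_d] obtain b
        where "b \<in> K" "\<forall>a\<in>K. d b \<le> d a" by blast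
      then show ?thesis using d_pos by (intro that[of "d b"]) auto
    qed
    \<comment> \<open>On \<open>K\<close>, where \<open>d\<close> is at least
      \<open>\<delta>\<close>, this slope makes the cone drop by at least \<open>2 * B\<close>,
      which bounds \<open>h p - h a\<close>.\<close>
    define g where "g a = h p * u a - 2 * B / \<delta> * d a" for a
    have "\<exists>x. lattice_term n e g x"
    proof -
      note u = lattice_term_unit[of n e, folded u_def]
      have "lattice_term n e (\<lambda>a. a k - p k * u a) (e k - p k *\<^sub>R (\<Sum>k<n. \<bar>e k\<bar>))" if "k < n" for k
        by (intro lattice_term_diff lattice_term_scale u lattice_term_coordinate that)
      then have "lattice_term n e d (\<Sum>k<n. \<bar>e k - p k *\<^sub>R (\<Sum>k<n. \<bar>e k\<bar>)\<bar>)"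
        unfolding d_def by (intro lattice_term_sum lattice_term_abs) auto
      from lattice_term_diff[OF lattice_term_scale[OF u, of "h p"] lattice_term_scale[OF this, of "2 * B / \<delta>"]]
      show ?thesis unfolding g_def by blast
    qed
    then obtain x where x: "lattice_term n e g x" ..
    have "g a \<le> h a + \<epsilon>" if a: "a \<in> S" for a
    proof (cases "a \<in> K")
      case True
      then have "2 * B \<le> 2 * B / \<delta> * d a"
        using \<delta> B(2) mult_left_mono[of \<delta> "d a" "2 * B / \<delta>"] by simp
      with B(1)[OF a] B(1)[OF p] a \<epsilon> show ?thesis by (auto simp: g_def S_def)
    next
      case False
      have "0 \<le> 2 * B / \<delta> * d a" using B(2) \<delta> d_nonneg by simp
      with False a \<epsilon> show ?thesis by (auto simp: g_def K_def S_def)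
    qed
    moreover have "g p = h p"
      using p by (simp add: g_def d_def S_def)
    ultimately show ?thesis using x by blast
  qed
  then obtain G X where G: "\<And>p. p \<in> S \<Longrightarrow> lattice_term n e (G p) (X p)"
    "\<And>p a. p \<in> S \<Longrightarrow> a \<in> S \<Longrightarrow> G p a \<le> h a + \<epsilon>" "\<And>p. p \<in> S \<Longrightarrow> G p p = h p"
    by metis
  have "\<exists>g x. lattice_term n e g x \<and> (\<forall>a\<in>S. \<bar>h a - g a\<bar> \<le> \<epsilon>)"
  proof (cases "S = {}")
    case True
    then show ?thesis using lattice_term_zero by blast
  next
    case False
    \<comment> \<open>Each cone exceeds \<open>h - \<epsilon>\<close> near its apex. Finitely many
      such neighbourhoods cover \<open>S\<close>, and the maximum of their cones stays below
      \<open>h + \<epsilon>\<close>.\<close>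
    have "open {a. h a - \<epsilon> < G p a}" if "p \<in> S" for p
      by (intro open_Collect_less continuous_intros cont
          pos_hom_functions_continuous_on[OF lattice_term_pos_hom[OF G(1)[OF that]]])
    moreover have "S \<subseteq> (\<Union>p\<in>S. {a. h a - \<epsilon> < G p a})"
      using G(3) \<epsilon> by auto
    ultimately obtain T where T: "T \<subseteq> S" "finite T" "S \<subseteq> (\<Union>p\<in>T. {a. h a - \<epsilon> < G p a})"
      by (rule compactE_image[OF comp])
    with False have "T \<noteq> {}" by auto
    let ?g = "\<lambda>a. Max ((\<lambda>p. G p a) ` T)"
    have "\<bar>h a - ?g a\<bar> \<le> \<epsilon>" if a: "a \<in> S" for a
    proof -
      obtain p where "p \<in> T" "h a - \<epsilon> < G p a" using T(3) a by auto
      moreover from \<open>p \<in> T\<close> have "G p a \<le> ?g a"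
        using T(2) by (intro Max_ge) auto
      moreover have "?g a \<le> h a + \<epsilon>"
        using T \<open>T \<noteq> {}\<close> G(2) a by (subst Max_le_iff) auto
      ultimately show ?thesis by (simp add: abs_le_iff)
    qed
    then show ?thesis
      using lattice_term_Sup_fin[OF T(2) \<open>T \<noteq> {}\<close>, of n e G X] G(1) T(1) by blast
  qed
  then obtain g x where g: "lattice_term n e g x" "\<And>a. a \<in> S \<Longrightarrow> \<bar>h a - g a\<bar> \<le> \<epsilon>" by blast
  have "\<bar>h a - g a\<bar> \<le> \<epsilon> * u a" for a
  proof -
    define b where "b = (\<lambda>k. if k < n then a k / u a else 0)"
    have u: "u a \<ge> 0" unfolding u_def by (intro sum_nonneg) auto
    have "h a = u a * h b" "g a = u a * g b"
      using pos_hom_functions_normalize[OF h, of a]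
        pos_hom_functions_normalize[OF lattice_term_pos_hom[OF g(1)], of a]
      unfolding u_def b_def .
    then have "h a - g a = u a * (h b - g b)"
      by (simp only: right_diff_distrib)
    then have "\<bar>h a - g a\<bar> = u a * \<bar>h b - g b\<bar>" using u by (simp add: abs_mult)
    also have "\<dots> \<le> u a * \<epsilon>"
      using g(2)[of b] S_I[of a] u by (cases "u a = 0") (auto simp: b_def intro: mult_left_mono)
    finally show ?thesis by (simp add: mult.commute)
  qed
  with g(1) show ?thesis by (auto simp: u_def)
qed

section \<open>Krivine's functional calculus\<close>

text \<open>Allowing arbitrary approximating terms, instead of one fixed sequence, lets the value of
  a combined function be verified by combining approximations of its parts.\<close>

definition krivine_value ::
    "nat \<Rightarrow> (nat \<Rightarrow> 'e::banach_lattice) \<Rightarrow> ((nat \<Rightarrow> real) \<Rightarrow> real) \<Rightarrow> 'e \<Rightarrow> bool" where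
  "krivine_value n e h y \<longleftrightarrow> (\<forall>\<epsilon>>0. \<exists>g x. lattice_term n e g x \<and>
     (\<forall>a. \<bar>h a - g a\<bar> \<le> \<epsilon> * (\<Sum>k<n. \<bar>a k\<bar>)) \<and> norm (x - y) \<le> \<epsilon>)"

lemma krivine_valueE:
  assumes "krivine_value n e h y" "0 < \<epsilon>"
  obtains g x where "lattice_term n e g x" "\<And>a. \<bar>h a - g a\<bar> \<le> \<epsilon> * (\<Sum>k<n. \<bar>a k\<bar>)"
    "norm (x - y) \<le> \<epsilon>"
  using assms unfolding krivine_value_def by metis

lemma krivine_value_unique:
  assumes "krivine_value n e h y" "krivine_value n e h z"
  shows "y = z"
proof -
  define U where "U = norm (\<Sum>k<n. \<bar>e k\<bar>)"
  have "norm (y - z) \<le> 0 + \<epsilon>" if "\<epsilon> > 0" for \<epsilon>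
  proof -
    \<comment> \<open>Two approximation errors \<open>\<delta>\<close> and the transfer bound
      \<open>2 * \<delta> * U\<close> add up to \<open>\<epsilon>\<close>.\<close>
    define \<delta> where "\<delta> = \<epsilon> / (2 + 2 * U)"
    have U: "U \<ge> 0" by (simp add: U_def)
    with that have \<delta>: "\<delta> > 0" by (simp add: \<delta>_def add_pos_nonneg)
    obtain g x where g: "lattice_term n e g x" "\<And>a. \<bar>h a - g a\<bar> \<le> \<delta> * (\<Sum>k<n. \<bar>a k\<bar>)" "norm (x - y) \<le> \<delta>"
      using krivine_valueE[OF assms(1) \<delta>] by metis
    obtain g' x' where g': "lattice_term n e g' x'" "\<And>a. \<bar>h a - g' a\<bar> \<le> \<delta> * (\<Sum>k<n. \<bar>a k\<bar>)" "norm (x' - z) \<le> \<delta>"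
      using krivine_valueE[OF assms(2) \<delta>] by metis
    have "\<bar>g a - g' a\<bar> \<le> (2 * \<delta>) * (\<Sum>k<n. \<bar>a k\<bar>)" for a
    proof -
      have "\<bar>g a - g' a\<bar> \<le> \<bar>h a - g a\<bar> + \<bar>h a - g' a\<bar>" by linarith
      also have "\<dots> \<le> \<delta> * (\<Sum>k<n. \<bar>a k\<bar>) + \<delta> * (\<Sum>k<n. \<bar>a k\<bar>)"
        by (intro add_mono g(2) g'(2))
      finally show ?thesis by (simp only: mult_2 distrib_right)
    qed
    then have "norm (x - x') \<le> \<bar>2 * \<delta>\<bar> * U"
      unfolding U_def by (rule lattice_term_norm_diff_le[OF g(1) g'(1)])
    moreover have "norm ((x - x') - (x - y) + (x' - z)) \<le> norm (x - x') + norm (x - y) + norm (x' - z)"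
      using norm_triangle_ineq[of "(x - x') - (x - y)" "x' - z"] norm_triangle_ineq4[of "x - x'" "x - y"]
      by linarith
    then have "norm (y - z) \<le> norm (x - x') + norm (x - y) + norm (x' - z)"
      by simp
    ultimately have "norm (y - z) \<le> \<delta> * (2 + 2 * U)"
      using g(3) g'(3) \<delta> by (simp add: algebra_simps)
    also have "\<dots> = \<epsilon>" using U by (simp add: \<delta>_def)
    finally show ?thesis by simp
  qed
  then have "norm (y - z) \<le> 0" by (rule field_le_epsilon)
  then show ?thesis by simp
qed

text \<open>Density provides terms with error \<open>1 / (m + 1)\<close>; their values at
  \<open>e\<close> are Cauchy by \<open>lattice_term_norm_diff_le\<close>, and completeness gives
  the limit.\<close>

lemma krivine_value_exists:
  assumes h: "h \<in> pos_hom_functions n"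
  shows "\<exists>y. krivine_value n e h y"
proof -
  define U where "U = norm (\<Sum>k<n. \<bar>e k\<bar>)"
  have U: "U \<ge> 0" by (simp add: U_def)
  define \<epsilon> where "\<epsilon> m = inverse (real (Suc m))" for m
  have \<epsilon>: "\<epsilon> m > 0" for m by (simp add: \<epsilon>_def)
  have lim: "\<epsilon> \<longlonglongrightarrow> 0" unfolding \<epsilon>_def by (rule LIMSEQ_inverse_real_of_nat)
  obtain g x where g: "\<And>m. lattice_term n e (g m) (x m)"
      "\<And>m a. \<bar>h a - g m a\<bar> \<le> \<epsilon> m * (\<Sum>k<n. \<bar>a k\<bar>)"
    using lattice_term_dense[OF h \<epsilon>, of e] by metis
  have diff: "norm (x m - x l) \<le> (\<epsilon> m + \<epsilon> l) * U" for m l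
  proof -
    have "\<bar>g m a - g l a\<bar> \<le> (\<epsilon> m + \<epsilon> l) * (\<Sum>k<n. \<bar>a k\<bar>)" for a
      using g(2)[of a m] g(2)[of a l] unfolding distrib_right by linarith
    then show ?thesis
      using lattice_term_norm_diff_le[OF g(1) g(1), of m l "\<epsilon> m + \<epsilon> l"] \<epsilon>[of m] \<epsilon>[of l]
      by (simp add: U_def)
  qed
  have "Cauchy x"
  proof (rule CauchyI)
    fix r :: real assume r: "0 < r"
    from order_tendstoD(2)[OF tendsto_mult_left[OF lim, of "2 * U"], of r] r
    obtain M where M: "\<And>m. m \<ge> M \<Longrightarrow> 2 * U * \<epsilon> m < r"
      unfolding eventually_sequentially by auto
    have "norm (x m - x l) < r" if "m \<ge> M" "l \<ge> M" for m l
      using diff[of m l] M[OF that(1)] M[OF that(2)] by (simp add: algebra_simps)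
    then show "\<exists>M. \<forall>m\<ge>M. \<forall>l\<ge>M. norm (x m - x l) < r" by blast
  qed
  then obtain y where y: "x \<longlonglongrightarrow> y" using Cauchy_convergent convergent_def by blast
  have "krivine_value n e h y"
    unfolding krivine_value_def
  proof (intro allI impI)
    fix r :: real assume r: "r > 0"
    have "eventually (\<lambda>m. \<epsilon> m < r) sequentially"
      using order_tendstoD(2)[OF lim r] .
    moreover have "eventually (\<lambda>m. dist (x m) y < r) sequentially"
      using tendstoD[OF y r] .
    ultimately obtain m where m: "\<epsilon> m < r" "dist (x m) y < r"
      using eventually_happens'[OF sequentially_bot eventually_conj] by blast
    have "\<epsilon> m * (\<Sum>k<n. \<bar>a k\<bar>) \<le> r * (\<Sum>k<n. \<bar>a k\<bar>)" for a :: "nat \<Rightarrow> real"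
      using m(1) by (intro mult_right_mono sum_nonneg) auto
    then have "\<bar>h a - g m a\<bar> \<le> r * (\<Sum>k<n. \<bar>a k\<bar>)" for a
      using g(2)[of a m] order_trans by blast
    with g(1)[of m] m(2) show "\<exists>g x. lattice_term n e g x \<and> (\<forall>a. \<bar>h a - g a\<bar> \<le> r * (\<Sum>k<n. \<bar>a k\<bar>)) \<and> norm (x - y) \<le> r"
      by (auto simp: dist_norm intro: less_imp_le)
  qed
  then show ?thesis ..
qed

lemma krivine_value_lattice_term:
  "lattice_term n e h x \<Longrightarrow> krivine_value n e h x"
  unfolding krivine_value_def by (intro allI impI exI[of _ h] exI[of _ x]) (simp add: sum_nonneg)

lemma krivine_value_scale:
  assumes "krivine_value n e h y"
  shows "krivine_value n e (\<lambda>a. c * h a) (c *\<^sub>R y)"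
  unfolding krivine_value_def
proof (intro allI impI)
  fix \<epsilon> :: real assume \<epsilon>: "\<epsilon> > 0"
  define \<delta> where "\<delta> = \<epsilon> / (1 + \<bar>c\<bar>)"
  have \<delta>: "\<delta> > 0" "\<bar>c\<bar> * \<delta> \<le> \<epsilon>" using \<epsilon> by (auto simp: \<delta>_def field_simps)
  obtain g x where g: "lattice_term n e g x" "\<And>a. \<bar>h a - g a\<bar> \<le> \<delta> * (\<Sum>k<n. \<bar>a k\<bar>)" "norm (x - y) \<le> \<delta>"
    using krivine_valueE[OF assms \<delta>(1)] by metis
  show "\<exists>g x. lattice_term n e g x \<and> (\<forall>a. \<bar>c * h a - g a\<bar> \<le> \<epsilon> * (\<Sum>k<n. \<bar>a k\<bar>)) \<and> norm (x - c *\<^sub>R y) \<le> \<epsilon>"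
  proof (intro exI conjI allI)
    show "lattice_term n e (\<lambda>a. c * g a) (c *\<^sub>R x)" by (rule lattice_term_scale[OF g(1)])
    show "\<bar>c * h a - c * g a\<bar> \<le> \<epsilon> * (\<Sum>k<n. \<bar>a k\<bar>)" for a
    proof -
      have "\<bar>c * h a - c * g a\<bar> = \<bar>c\<bar> * \<bar>h a - g a\<bar>"
        by (simp add: right_diff_distrib[symmetric] abs_mult)
      also have "\<dots> \<le> \<bar>c\<bar> * (\<delta> * (\<Sum>k<n. \<bar>a k\<bar>))" by (intro mult_left_mono g) auto
      also have "\<dots> \<le> \<epsilon> * (\<Sum>k<n. \<bar>a k\<bar>)"
        unfolding mult.assoc[symmetric] by (intro mult_right_mono \<delta> sum_nonneg) auto
      finally show ?thesis .
    qed
    have "norm (c *\<^sub>R x - c *\<^sub>R y) = \<bar>c\<bar> * norm (x - y)"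
      by (simp add: scaleR_diff_right[symmetric])
    also have "\<dots> \<le> \<bar>c\<bar> * \<delta>" by (intro mult_left_mono g) auto
    finally show "norm (c *\<^sub>R x - c *\<^sub>R y) \<le> \<epsilon>" using \<delta> by simp
  qed
qed

text \<open>A common argument for sum, maximum and minimum: each preserves lattice terms and is
  1-Lipschitz for the sum of the two distances, over the reals as well as in the lattice.\<close>

lemma krivine_value_binary:
  fixes f :: "real \<Rightarrow> real \<Rightarrow> real" and F :: "'e::banach_lattice \<Rightarrow> 'e \<Rightarrow> 'e"
  assumes "krivine_value n e h y" "krivine_value n e h' y'"
    and lt: "\<And>g x g' x'. lattice_term n e g x \<Longrightarrow> lattice_term n e g' x' \<Longrightarrow>
      lattice_term n e (\<lambda>a. f (g a) (g' a)) (F x x')"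
    and f: "\<And>s t s' t'. \<bar>f s t - f s' t'\<bar> \<le> \<bar>s - s'\<bar> + \<bar>t - t'\<bar>"
    and F: "\<And>s t s' t'. norm (F s t - F s' t') \<le> norm (s - s') + norm (t - t')"
  shows "krivine_value n e (\<lambda>a. f (h a) (h' a)) (F y y')"
  unfolding krivine_value_def
proof (intro allI impI)
  fix \<epsilon> :: real assume \<epsilon>: "\<epsilon> > 0"
  then have \<epsilon>2: "\<epsilon> / 2 > 0" by simp
  obtain g x where g: "lattice_term n e g x" "\<And>a. \<bar>h a - g a\<bar> \<le> \<epsilon> / 2 * (\<Sum>k<n. \<bar>a k\<bar>)" "norm (x - y) \<le> \<epsilon> / 2"
    using krivine_valueE[OF assms(1) \<epsilon>2] by metis
  obtain g' x' where g': "lattice_term n e g' x'" "\<And>a. \<bar>h' a - g' a\<bar> \<le> \<epsilon> / 2 * (\<Sum>k<n. \<bar>a k\<bar>)" "norm (x' - y') \<le> \<epsilon> / 2"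
    using krivine_valueE[OF assms(2) \<epsilon>2] by metis
  show "\<exists>g x. lattice_term n e g x \<and> (\<forall>a. \<bar>f (h a) (h' a) - g a\<bar> \<le> \<epsilon> * (\<Sum>k<n. \<bar>a k\<bar>)) \<and> norm (x - F y y') \<le> \<epsilon>"
  proof (intro exI conjI allI)
    show "lattice_term n e (\<lambda>a. f (g a) (g' a)) (F x x')" by (rule lt[OF g(1) g'(1)])
    show "\<bar>f (h a) (h' a) - f (g a) (g' a)\<bar> \<le> \<epsilon> * (\<Sum>k<n. \<bar>a k\<bar>)" for a
      using f[of "h a" "h' a" "g a" "g' a"] g(2)[of a] g'(2)[of a] by linarith
    show "norm (F x x' - F y y') \<le> \<epsilon>"
      using F[of x x' y y'] g(3) g'(3) by linarith
  qed
qed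

text \<open>By uniqueness, each homomorphism law follows once its right-hand side is shown to be a
  value of the combined function.\<close>

lemma krivine_hom_exists: "\<exists>\<Phi>. krivine_hom n e \<Phi>"
proof -
  define \<Phi> where "\<Phi> h = (SOME y. krivine_value n e h y)" for h
  have eq: "\<Phi> h = y" if "krivine_value n e h y" for h y
    unfolding \<Phi>_def using that by (blast intro: krivine_value_unique someI)
  have val: "krivine_value n e h (\<Phi> h)" if "h \<in> pos_hom_functions n" for h
    using krivine_value_exists[OF that] eq by blast
  have "krivine_hom n e \<Phi>"
    unfolding krivine_hom_def
  proof (intro conjI ballI allI impI)
    fix k assume "k < n"
    then show "\<Phi> (\<lambda>a. a k) = e k"
      by (intro eq krivine_value_lattice_term lattice_term_coordinate)
  next
    fix g c assume "g \<in> pos_hom_functions n"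
    then show "\<Phi> (\<lambda>a. c * g a) = c *\<^sub>R \<Phi> g"
      by (intro eq krivine_value_scale val)
  next
    fix g h assume gh: "g \<in> pos_hom_functions n" "h \<in> pos_hom_functions n"
    show "\<Phi> (\<lambda>a. g a + h a) = \<Phi> g + \<Phi> h"
      by (rule eq, rule krivine_value_binary[OF val[OF gh(1)] val[OF gh(2)]])
        (auto intro: lattice_term_add norm_diff_triangle_ineq)
    show "\<Phi> (\<lambda>a. max (g a) (h a)) = sup (\<Phi> g) (\<Phi> h)"
      by (rule eq, rule krivine_value_binary[OF val[OF gh(1)] val[OF gh(2)]])
        (rule lattice_term.sup norm_sup_diff_le; assumption | linarith)+
    show "\<Phi> (\<lambda>a. min (g a) (h a)) = inf (\<Phi> g) (\<Phi> h)"
      by (rule eq, rule krivine_value_binary[OF val[OF gh(1)] val[OF gh(2)]])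
        (rule lattice_term.inf norm_inf_diff_le; assumption | linarith)+
  qed
  then show ?thesis by (rule exI[of _ \<Phi>])
qed

section \<open>Evaluation and monotonicity of the calculus\<close>

lemma krivine_hom_krivine: "krivine_hom n e (krivine n e)"
  unfolding krivine_def by (rule someI_ex[OF krivine_hom_exists])

lemma krivine_coordinate: "k < n \<Longrightarrow> krivine n e (\<lambda>a. a k) = e k"
  using krivine_hom_krivine[of n e] by (simp add: krivine_hom_def)

lemma krivine_scale:
  "g \<in> pos_hom_functions n \<Longrightarrow> krivine n e (\<lambda>a. c * g a) = c *\<^sub>R krivine n e g"
  using krivine_hom_krivine[of n e] by (simp add: krivine_hom_def)

lemma
  assumes "g \<in> pos_hom_functions n" "h \<in> pos_hom_functions n"
  shows krivine_add: "krivine n e (\<lambda>a. g a + h a) = krivine n e g + krivine n e h"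
    and krivine_max: "krivine n e (\<lambda>a. max (g a) (h a)) = sup (krivine n e g) (krivine n e h)"
    and krivine_min: "krivine n e (\<lambda>a. min (g a) (h a)) = inf (krivine n e g) (krivine n e h)"
  using krivine_hom_krivine[of n e] assms by (simp_all add: krivine_hom_def)

lemma krivine_linear: "krivine n e (\<lambda>a. \<Sum>k<n. c k * a k) = (\<Sum>k<n. c k *\<^sub>R e k)"
proof -
  have coord: "(\<lambda>a. a k) \<in> pos_hom_functions n" if "k < n" for k
    by (rule lattice_term_pos_hom[OF lattice_term_coordinate[OF that]])
  have sums: "(\<lambda>a. \<Sum>k<m. c k * a k) \<in> pos_hom_functions n" if "m \<le> n" for m
    by (rule lattice_term_pos_hom[OF lattice_term_sum[OF finite_lessThan
            lattice_term_scale[OF lattice_term_coordinate]]]) (use that in auto)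
  have "krivine n e (\<lambda>a. \<Sum>k<m. c k * a k) = (\<Sum>k<m. c k *\<^sub>R e k)" if "m \<le> n" for m
    using that
  proof (induction m)
    case 0
    show ?case using krivine_scale[OF sums[of 0], of e 0] by simp
  next
    case (Suc m)
    then have m: "m < n" by simp
    have "(\<lambda>a. c m * a m) \<in> pos_hom_functions n"
      by (rule lattice_term_pos_hom[OF lattice_term_scale[OF lattice_term_coordinate[OF m]]])
    from krivine_add[OF sums this, of m e] show ?case
      using Suc krivine_scale[OF coord[OF m], of e "c m"] krivine_coordinate[OF m, of e] by simp
  qed
  then show ?thesis by blast
qed

text \<open>Although \<open>krivine\<close> is an arbitrary choice among homomorphisms, the
  homomorphism laws force its values on lattice terms.\<close>

lemma krivine_lattice_term:
  assumes "lattice_term n e h x"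
  shows "krivine n e h = x"
  using assms
proof induction
  case (sup g x h y)
  then show ?case
    using krivine_max[of g n h e] lattice_term_pos_hom[of n e] by simp
next
  case (inf g x h y)
  then show ?case
    using krivine_min[of g n h e] lattice_term_pos_hom[of n e] by simp
qed (rule krivine_linear)

text \<open>The pointwise order is the equation \<open>max g h = h\<close>, which a lattice
  homomorphism preserves.\<close>

lemma krivine_mono:
  assumes "g \<in> pos_hom_functions n" "h \<in> pos_hom_functions n" "\<And>a. g a \<le> h a"
  shows "krivine n e g \<le> krivine n e h"
proof -
  have "krivine n e (\<lambda>a. max (g a) (h a)) = sup (krivine n e g) (krivine n e h)"
    by (rule krivine_max[OF assms(1,2)])
  moreover have "(\<lambda>a. max (g a) (h a)) = h"
    using assms(3) by (simp add: max_absorb2)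
  ultimately show ?thesis by (simp add: le_iff_sup)
qed

section \<open>Discretized Pareto variables\<close>

lemma powr_diff_ge:
  fixes p :: real
  assumes "p \<noteq> 0" "p < 1" "0 < x"
  shows "(x + 1) powr (p - 1) \<le> ((x + 1) powr p - x powr p) / p"
proof -
  have "\<exists>z. x < z \<and> z < x + 1 \<and> (x + 1) powr p - x powr p = (x + 1 - x) * (p * z powr (p - 1))"
    by (rule MVT2) (use assms in \<open>auto intro!: has_real_derivative_powr\<close>)
  then obtain z where z: "x < z" "z < x + 1" "(x + 1) powr p - x powr p = p * z powr (p - 1)"
    by auto
  have "(x + 1) powr (p - 1) \<le> z powr (p - 1)"
    using z assms by (intro powr_mono2') auto
  then show ?thesis using z assms by simp
qed

text \<open>Telescoped comparison with the integral of \<open>x powr (p - 1)\<close>. Both signs of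
  \<open>p\<close> occur below: positive for initial segments, negative for tails.\<close>

lemma sum_powr_le:
  fixes p :: real
  assumes "p \<noteq> 0" "p < 1" "1 \<le> m" "m \<le> M"
  shows "(\<Sum>j=Suc m..M. real j powr (p - 1)) \<le> (real M powr p - real m powr p) / p"
  using assms(4)
proof (induction M rule: dec_induct)
  case (step M)
  have "(\<Sum>j=Suc m..Suc M. real j powr (p - 1)) =
      (\<Sum>j=Suc m..M. real j powr (p - 1)) + (real M + 1) powr (p - 1)"
    using step by (simp add: add.commute)
  also have "\<dots> \<le> (real M powr p - real m powr p) / p + ((real M + 1) powr p - real M powr p) / p"
    using step assms by (intro add_mono powr_diff_ge) auto
  finally show ?case by (simp add: diff_divide_distrib add.commute)
qed simp

lemma sum_powr_from_1_le:
  fixes p :: real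
  assumes "0 < p" "p < 1"
  shows "(\<Sum>j=1..M. real j powr (p - 1)) \<le> real M powr p / p"
proof (cases "M = 0")
  case False
  then have "(\<Sum>j=1..M. real j powr (p - 1)) = 1 + (\<Sum>j=Suc 1..M. real j powr (p - 1))"
    by (subst sum.atLeast_Suc_atMost) auto
  also have "\<dots> \<le> 1 + (real M powr p - real 1 powr p) / p"
    using False assms by (intro add_left_mono sum_powr_le) auto
  also have "\<dots> \<le> real M powr p / p"
    using assms by (simp add: field_simps)
  finally show ?thesis .
qed simp

text \<open>The sum is cut near \<open>j = T\<close>: the exponent \<open>\<beta>\<close> serves
  before the cut and \<open>\<alpha>\<close> after it, while the single term at the cut is at most
  \<open>T\<close>. These are the three parts of the constant.\<close>

lemma sum_min_powr_le:
  fixes T \<alpha> \<beta> :: real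
  assumes T: "0 < T" and \<alpha>: "1 < \<alpha>" and \<beta>: "0 < \<beta>" "\<beta> < 1"
  shows "(\<Sum>j=1..N. min ((T / real j) powr \<alpha>) ((T / real j) powr \<beta>)) \<le>
    (1 / (1 - \<beta>) + 1 + 1 / (\<alpha> - 1)) * T"
proof -
  define m where "m = nat \<lfloor>T\<rfloor>"
  \<comment> \<open>Extending the range past the cut makes all three pieces available even when
    \<open>N\<close> is smaller than \<open>T\<close>.\<close>
  define M where "M = max N (Suc m)"
  have m: "real m \<le> T" "T < real m + 1"
    using T unfolding m_def by linarith+
  let ?g = "\<lambda>j. min ((T / real j) powr \<alpha>) ((T / real j) powr \<beta>)"
  have "(\<Sum>j=1..N. ?g j) \<le> (\<Sum>j\<in>{1..m} \<union> {Suc m..M}. ?g j)"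
    by (intro sum_mono2) (auto simp: M_def)
  also have "\<dots> = (\<Sum>j=1..m. ?g j) + (\<Sum>j=Suc m..M. ?g j)"
    by (intro sum.union_disjoint) auto
  also have "(\<Sum>j=Suc m..M. ?g j) = ?g (Suc m) + (\<Sum>j=Suc (Suc m)..M. ?g j)"
    by (subst sum.atLeast_Suc_atMost) (auto simp: M_def)
  also have "(\<Sum>j=1..m. ?g j) \<le> T / (1 - \<beta>)"
  proof -
    have "(\<Sum>j=1..m. ?g j) \<le> (\<Sum>j=1..m. T powr \<beta> * real j powr ((1 - \<beta>) - 1))"
      using T by (intro sum_mono) (auto simp: min_le_iff_disj powr_divide powr_minus_divide)
    also have "\<dots> \<le> T powr \<beta> * (real m powr (1 - \<beta>) / (1 - \<beta>))"
      unfolding sum_distrib_left[symmetric] using \<beta>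
      by (intro mult_left_mono sum_powr_from_1_le) auto
    also have "\<dots> \<le> T powr \<beta> * (T powr (1 - \<beta>) / (1 - \<beta>))"
      using \<beta> m by (intro mult_left_mono divide_right_mono powr_mono2) auto
    also have "\<dots> = T / (1 - \<beta>)"
      using T by (simp add: powr_add[symmetric])
    finally show ?thesis .
  qed
  also have "?g (Suc m) \<le> T"
  proof -
    have "(T / real (Suc m)) powr \<alpha> \<le> (T / real (Suc m)) powr 1"
      using T m \<alpha> by (intro powr_mono') auto
    also have "\<dots> \<le> T" using T by (simp add: field_simps)
    finally show ?thesis by (simp add: min_le_iff_disj)
  qed
  also have "(\<Sum>j=Suc (Suc m)..M. ?g j) \<le> T / (\<alpha> - 1)"
  proof -
    have "(\<Sum>j=Suc (Suc m)..M. ?g j) \<le> (\<Sum>j=Suc (Suc m)..M. T powr \<alpha> * real j powr ((1 - \<alpha>) - 1))"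
      using T by (intro sum_mono) (auto simp: min_le_iff_disj powr_divide powr_minus_divide)
    also have "\<dots> \<le> T powr \<alpha> * ((real M powr (1 - \<alpha>) - real (Suc m) powr (1 - \<alpha>)) / (1 - \<alpha>))"
      unfolding sum_distrib_left[symmetric] using \<alpha>
      by (intro mult_left_mono sum_powr_le) (auto simp: M_def)
    also have "\<dots> \<le> T powr \<alpha> * (real (Suc m) powr (1 - \<alpha>) / (\<alpha> - 1))"
    proof (intro mult_left_mono)
      have "(real M powr (1 - \<alpha>) - real (Suc m) powr (1 - \<alpha>)) / (1 - \<alpha>) =
          (real (Suc m) powr (1 - \<alpha>) - real M powr (1 - \<alpha>)) / (\<alpha> - 1)"
        by (metis minus_diff_eq minus_divide_divide)
      also have "\<dots> \<le> real (Suc m) powr (1 - \<alpha>) / (\<alpha> - 1)"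
        using \<alpha> by (intro divide_right_mono) auto
      finally show "(real M powr (1 - \<alpha>) - real (Suc m) powr (1 - \<alpha>)) / (1 - \<alpha>) \<le> \<dots>" .
    qed simp
    also have "\<dots> \<le> T powr \<alpha> * (T powr (1 - \<alpha>) / (\<alpha> - 1))"
      using \<alpha> m T by (intro mult_left_mono divide_right_mono powr_mono2') auto
    also have "\<dots> = T / (\<alpha> - 1)"
      using T by (simp add: powr_add[symmetric])
    finally show ?thesis .
  qed
  finally show ?thesis by (simp add: algebra_simps)
qed

lemma powr_superadditive:
  fixes x y r :: real
  assumes "0 \<le> x" "0 \<le> y" "1 \<le> r"
  shows "x powr r + y powr r \<le> (x + y) powr r"
proof -
  have *: "z powr r = z * z powr (r - 1)" if "0 \<le> z" for z
    using that by (cases "z = 0") (auto simp: powr_mult_base)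
  have "x powr r + y powr r = x * x powr (r - 1) + y * y powr (r - 1)"
    using assms * by simp
  also have "\<dots> \<le> x * (x + y) powr (r - 1) + y * (x + y) powr (r - 1)"
    using assms by (intro add_mono mult_left_mono powr_mono2) auto
  also have "\<dots> = (x + y) powr r"
    using assms *[of "x + y"] by (simp add: distrib_right)
  finally show ?thesis .
qed

text \<open>The right side is a sum of functions of single entries, so its expectation only involves
  marginals. The leading 1 keeps the running bound \<open>M\<close> at least 1: large entries enter
  by superadditivity, small ones because \<open>w \<le> w * M powr (r - 1)\<close>.\<close>

lemma l_r_norm_le:
  fixes y :: "nat \<Rightarrow> real"
  assumes "\<And>k. k < n \<Longrightarrow> 0 \<le> y k" "1 \<le> r"
  shows "(\<Sum>k<n. y k powr r) powr (1 / r) \<le> 1 + (\<Sum>k<n. min (y k powr r) (y k))"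
proof -
  have "(\<Sum>k<n. y k powr r) \<le> (1 + (\<Sum>k<n. min (y k powr r) (y k))) powr r"
    using assms(1)
  proof (induction n)
    case (Suc n)
    define M where "M = 1 + (\<Sum>k<n. min (y k powr r) (y k))"
    have M: "M \<ge> 1" unfolding M_def using Suc by (intro le_add_same_cancel1[THEN iffD2] sum_nonneg) auto
    have y: "0 \<le> y n" using Suc by simp
    have IH: "(\<Sum>k<n. y k powr r) \<le> M powr r" using Suc by (simp add: M_def)
    have "M powr r + y n powr r \<le> (M + min (y n powr r) (y n)) powr r"
    proof (cases "y n \<le> y n powr r")
      case True
      then show ?thesis using powr_superadditive[of M "y n" r] M y assms by (simp add: min_def)
    next
      case False
      define w where "w = y n powr r"
      have w: "w \<ge> 0" by (simp add: w_def)
      have *: "z powr r = z * z powr (r - 1)" if "1 \<le> z" for z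
        using that by (simp add: powr_mult_base)
      have "M powr r + w \<le> M * M powr (r - 1) + w * M powr (r - 1)"
        using *[OF M] w mult_left_mono[of 1 "M powr (r - 1)" w] ge_one_powr_ge_zero[of M "r - 1"] M assms
        by simp
      also have "\<dots> = (M + w) * M powr (r - 1)" by (simp add: distrib_right)
      also have "\<dots> \<le> (M + w) * (M + w) powr (r - 1)"
        using M w assms by (intro mult_left_mono powr_mono2) auto
      also have "\<dots> = (M + w) powr r" using *[of "M + w"] M w by simp
      finally show ?thesis using False by (simp add: min_def w_def)
    qed
    with IH show ?case by (simp add: M_def algebra_simps)
  qed simp
  then have "(\<Sum>k<n. y k powr r) powr (1 / r) \<le> ((1 + (\<Sum>k<n. min (y k powr r) (y k))) powr r) powr (1 / r)"
    using assms by (intro powr_mono2 sum_nonneg) auto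
  also have "\<dots> = 1 + (\<Sum>k<n. min (y k powr r) (y k))"
  proof -
    have "0 \<le> (\<Sum>k<n. min (y k powr r) (y k))"
      using assms by (intro sum_nonneg) auto
    then show ?thesis using assms by (simp add: powr_powr)
  qed
  finally show ?thesis .
qed

section \<open>Independent samples from a finite uniform distribution\<close>

lemma sum_PiE_marginal:
  fixes f :: "'b \<Rightarrow> real"
  assumes "finite I" "k \<in> I" "finite J"
  shows "(\<Sum>\<omega>\<in>PiE I (\<lambda>_. J). f (\<omega> k)) = real (card J) ^ (card I - 1) * (\<Sum>j\<in>J. f j)"
proof -
  have "(\<Sum>\<omega>\<in>PiE I (\<lambda>_. J). f (\<omega> k)) = (\<Sum>\<omega>\<in>PiE I (\<lambda>_. J). \<Prod>i\<in>I. if i = k then f (\<omega> i) else 1)"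
    using assms by (intro sum.cong) auto
  also have "\<dots> = (\<Prod>i\<in>I. \<Sum>j\<in>J. if i = k then f j else 1)"
    using assms by (intro prod_sum_PiE[symmetric]) auto
  also have "\<dots> = (\<Sum>j\<in>J. f j) * (\<Prod>i\<in>I - {k}. real (card J))"
    using assms by (subst prod.remove[of I k]) (auto intro!: prod.cong)
  finally show ?thesis using assms by (simp add: mult.commute)
qed

text \<open>
  If \<open>j\<close> is uniformly distributed on \<open>{1..N}\<close>, then \<open>pareto N q j\<close> approximately has tails
  \<open>t powr (-q)\<close>, so that the maximum of \<open>\<bar>a k\<bar> * pareto N q (\<omega> k)\<close> for independent \<open>\<omega> k\<close> is of the
  order of the \<open>q\<close>-norm of \<open>a\<close>.
\<close>

definition pareto :: "nat \<Rightarrow> real \<Rightarrow> nat \<Rightarrow> real" where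
  "pareto N q j = (real N / real j) powr (1 / q)"

abbreviation samples :: "nat \<Rightarrow> nat \<Rightarrow> (nat \<Rightarrow> nat) set" where
  "samples n N \<equiv> PiE {..<n} (\<lambda>_. {1..N})"

lemma card_large_le:
  fixes b :: real
  assumes "0 \<le> b" "b \<le> 1"
  shows "real (card {j \<in> {1..N}. real N * b < real j}) \<le> real N - real N * b + 1"
proof -
  define m where "m = nat \<lfloor>real N * b\<rfloor>"
  have m: "real m \<le> real N * b" "real N * b < real m + 1"
    using mult_nonneg_nonneg[of "real N" b] assms unfolding m_def by linarith+
  have "real m \<le> real N" using m(1) assms mult_left_mono[of b 1 "real N"] by simp
  then have mN: "m \<le> N" by simp
  have "{j \<in> {1..N}. real N * b < real j} \<subseteq> {Suc m..N}"
    using m(1) by auto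
  then have "card {j \<in> {1..N}. real N * b < real j} \<le> card {Suc m..N}"
    by (rule card_mono[rotated]) simp
  then have "real (card {j \<in> {1..N}. real N * b < real j}) \<le> real (N - m)" by simp
  with m mN show ?thesis by (simp add: of_nat_diff)
qed

text \<open>Let \<open>b k\<close> be the share of coordinate \<open>k\<close> in the sum of
  \<open>q\<close>-th powers. That coordinate alone reaches the \<open>q\<close>-norm with
  probability about \<open>b k\<close>. The shares add up to 1, so by independence all coordinates
  fail with probability at most \<open>exp (n / N - 1)\<close>, and the maximum succeeds with
  probability at least 1/3.\<close>

lemma q_norm_le_expectation_Max:
  fixes a :: "nat \<Rightarrow> real"
  assumes q: "0 < q" and n: "0 < n" and N: "2 * n \<le> N"
  shows "(\<Sum>k<n. \<bar>a k\<bar> powr q) powr (1 / q) * real N ^ n \<le>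
    3 * (\<Sum>\<omega>\<in>samples n N. Max ((\<lambda>k. pareto N q (\<omega> k) * \<bar>a k\<bar>) ` {..<n}))"
proof -
  define s where "s = (\<Sum>k<n. \<bar>a k\<bar> powr q)"
  define F where "F \<omega> = Max ((\<lambda>k. pareto N q (\<omega> k) * \<bar>a k\<bar>) ` {..<n})" for \<omega>
  have F_ge: "pareto N q (\<omega> k) * \<bar>a k\<bar> \<le> F \<omega>" if "k < n" for \<omega> k
    unfolding F_def using that by (intro Max_ge) auto
  have F_nonneg: "0 \<le> F \<omega>" for \<omega>
    by (rule order_trans[OF _ F_ge[OF n]]) (simp add: pareto_def)
  have N0: "0 < N" using n N by simp
  have fin: "finite (samples n N)" by (intro finite_PiE) auto
  have s: "s \<ge> 0" unfolding s_def by (intro sum_nonneg) auto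
  show ?thesis
  proof (cases "s = 0")
    case True
    then show ?thesis using F_nonneg by (simp add: s_def[symmetric] F_def[symmetric] sum_nonneg)
  next
    case False
    with s have s: "s > 0" by simp
    define b where "b k = \<bar>a k\<bar> powr q / s" for k
    have b: "0 \<le> b k" "k < n \<Longrightarrow> b k \<le> 1" for k
      using s member_le_sum[of k "{..<n}" "\<lambda>k. \<bar>a k\<bar> powr q"] by (auto simp: b_def s_def)
    have sum_b: "(\<Sum>k<n. b k) = 1"
      using s by (simp add: b_def sum_divide_distrib[symmetric] s_def[symmetric])
    \<comment> \<open>These samples are the ones at which coordinate \<open>k\<close> falls short of
      \<open>s powr (1 / q)\<close>; \<open>A\<close> is the event that some coordinate does
      not.\<close>
    define J where "J k = {j \<in> {1..N}. real N * b k < real j}" for k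
    define A where "A = samples n N - PiE {..<n} J"
    have sub: "PiE {..<n} J \<subseteq> samples n N" by (intro PiE_mono) (auto simp: J_def)
    have "real (card (PiE {..<n} J)) = (\<Prod>k<n. real (card (J k)))"
      by (simp add: card_PiE)
    also have "\<dots> \<le> (\<Prod>k<n. real N * exp (1 / real N - b k))"
    proof (intro prod_mono conjI)
      fix k assume "k \<in> {..<n}"
      then have "real (card (J k)) \<le> real N - real N * b k + 1"
        unfolding J_def using b by (intro card_large_le) auto
      also have "\<dots> = real N * (1 + (1 / real N - b k))"
        using N0 by (simp add: algebra_simps)
      also have "\<dots> \<le> real N * exp (1 / real N - b k)"
        by (intro mult_left_mono exp_ge_add_one_self) auto
      finally show "real (card (J k)) \<le> real N * exp (1 / real N - b k)" .
    qed auto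
    also have "\<dots> = real N ^ n * exp (real n / real N - 1)"
      by (simp add: prod.distrib exp_sum[symmetric] sum_subtractf sum_b)
    also have "\<dots> \<le> real N ^ n * (2 / 3)"
    proof (intro mult_left_mono)
      \<comment> \<open>The accumulated rounding loss \<open>n / N\<close> is at most one half; this
        is where \<open>2 * n \<le> N\<close> enters.\<close>
      have "real n / real N \<le> 1 / 2" using N N0 by (simp add: field_simps)
      then have "real n / real N - 1 \<le> - (1 / 2)" by linarith
      then have "exp (real n / real N - 1) \<le> exp (- (1 / 2))" by (simp only: exp_le_cancel_iff)
      also have "\<dots> = 1 / exp (1 / 2)" by (simp add: exp_minus inverse_eq_divide)
      also have "\<dots> \<le> 1 / (1 + 1 / 2)" by (intro divide_left_mono exp_ge_add_one_self) auto
      finally show "exp (real n / real N - 1) \<le> 2 / 3" by simp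
    qed auto
    finally have "real (card (PiE {..<n} J)) \<le> real N ^ n * (2 / 3)" .
    moreover have "card A = card (samples n N) - card (PiE {..<n} J)"
      unfolding A_def using sub fin by (intro card_Diff_subset finite_subset[OF sub]) auto
    then have "real (card A) = real N ^ n - real (card (PiE {..<n} J))"
      using card_mono[OF fin sub] by (simp add: card_PiE of_nat_diff)
    ultimately have card_A: "real N ^ n \<le> 3 * real (card A)" by simp
    have F_A: "s powr (1 / q) \<le> F \<omega>" if \<omega>: "\<omega> \<in> A" for \<omega>
    proof -
      obtain k where k: "k < n" "\<omega> k \<notin> J k"
        using \<omega> unfolding A_def PiE_iff by blast
      have \<omega>k: "1 \<le> \<omega> k" "\<omega> k \<le> N"
        using \<omega> k(1) PiE_mem[of \<omega> "{..<n}" "\<lambda>_. {1..N}" k] unfolding A_def by simp_all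
      with k have "real (\<omega> k) \<le> real N * b k" by (simp add: J_def)
      then have "s \<le> real N / real (\<omega> k) * \<bar>a k\<bar> powr q"
        using s \<omega>k by (simp add: b_def field_simps)
      then have "s powr (1 / q) \<le> (real N / real (\<omega> k) * \<bar>a k\<bar> powr q) powr (1 / q)"
        using s q by (intro powr_mono2) auto
      also have "\<dots> = pareto N q (\<omega> k) * \<bar>a k\<bar>"
        using q by (subst powr_mult) (simp_all add: powr_powr pareto_def)
      also have "\<dots> \<le> F \<omega>" by (rule F_ge[OF k(1)])
      finally show ?thesis .
    qed
    have "s powr (1 / q) * real N ^ n \<le> s powr (1 / q) * (3 * real (card A))"
      by (intro mult_left_mono card_A) auto
    also have "\<dots> = 3 * (\<Sum>\<omega>\<in>A. s powr (1 / q))" by simp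
    also have "\<dots> \<le> 3 * (\<Sum>\<omega>\<in>A. F \<omega>)"
      using F_A by (intro mult_left_mono sum_mono) auto
    also have "\<dots> \<le> 3 * (\<Sum>\<omega>\<in>samples n N. F \<omega>)"
      using F_nonneg fin by (intro mult_left_mono sum_mono2) (auto simp: A_def)
    finally show ?thesis unfolding s_def F_def .
  qed
qed

text \<open>After scaling to \<open>q\<close>-norm 1, \<open>l_r_norm_le\<close> reduces the claim
  to marginals. By \<open>sum_min_powr_le\<close> with exponents \<open>r / q\<close> and
  \<open>1 / q\<close>, the marginal average of coordinate \<open>k\<close> is at most
  \<open>C * l k powr q\<close>, and these bounds add up to \<open>C\<close>.\<close>

lemma expectation_r_norm_le:
  fixes c :: "nat \<Rightarrow> real"
  assumes q: "1 < q" and r: "q < r" and N: "0 < N" and c: "\<And>k. 0 \<le> c k"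
  defines "C \<equiv> 1 / (1 - 1 / q) + 1 + 1 / (r / q - 1)"
  shows "(\<Sum>\<omega>\<in>samples n N. (\<Sum>k<n. (pareto N q (\<omega> k) * c k) powr r) powr (1 / r)) \<le>
    real N ^ n * ((1 + C) * (\<Sum>k<n. c k powr q) powr (1 / q))"
proof -
  define s where "s = (\<Sum>k<n. c k powr q)"
  have s: "s \<ge> 0" unfolding s_def by (intro sum_nonneg) auto
  have C: "0 \<le> C" using q r by (simp add: C_def)
  have fin: "finite (samples n N)" by (intro finite_PiE) auto
  show ?thesis
  proof (cases "s = 0")
    case True
    then have "c k = 0" if "k < n" for k
      using that c unfolding s_def by (subst (asm) sum_nonneg_eq_0_iff) auto
    then show ?thesis using C by simp
  next
    case False
    with s have s: "s > 0" by simp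
    define t where "t = s powr (1 / q)"
    have t: "t > 0" "t powr q = s" using s q by (auto simp: t_def powr_powr)
    define l where "l k = c k / t" for k
    have l: "0 \<le> l k" for k using c t by (simp add: l_def)
    have sum_l: "(\<Sum>k<n. l k powr q) = 1"
      using t c s by (simp add: l_def powr_divide sum_divide_distrib[symmetric] s_def[symmetric])
    let ?\<phi> = "\<lambda>y. min (y powr r) y"
    have \<phi>: "(\<Sum>j=1..N. ?\<phi> (pareto N q j * l k)) \<le> C * (real N * l k powr q)" for k
    proof (cases "l k = 0")
      case False
      with l[of k] have lk: "l k > 0" by simp
      have eq: "(real N / real j) powr (1 / q) * l k = (real N * l k powr q / real j) powr (1 / q)" for j
        using lk q by (simp add: powr_mult powr_divide powr_powr)
      have "?\<phi> (pareto N q j * l k) = min ((real N * l k powr q / real j) powr (r / q))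
          ((real N * l k powr q / real j) powr (1 / q))" for j
        unfolding pareto_def eq by (simp add: powr_powr)
      then show ?thesis
        using sum_min_powr_le[of "real N * l k powr q" "r / q" "1 / q" N] lk N q r by (simp add: C_def)
    qed simp
    have "(\<Sum>\<omega>\<in>samples n N. (\<Sum>k<n. (pareto N q (\<omega> k) * c k) powr r) powr (1 / r)) =
        (\<Sum>\<omega>\<in>samples n N. t * (\<Sum>k<n. (pareto N q (\<omega> k) * l k) powr r) powr (1 / r))"
    proof (intro sum.cong refl)
      fix \<omega>
      have "(pareto N q (\<omega> k) * c k) powr r = t powr r * (pareto N q (\<omega> k) * l k) powr r" for k
        using t c by (simp add: l_def powr_mult[symmetric] pareto_def)
      then have "(\<Sum>k<n. (pareto N q (\<omega> k) * c k) powr r) =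
          t powr r * (\<Sum>k<n. (pareto N q (\<omega> k) * l k) powr r)"
        by (simp only: sum_distrib_left)
      also have "\<dots> powr (1 / r) = (t powr r) powr (1 / r) * (\<Sum>k<n. (pareto N q (\<omega> k) * l k) powr r) powr (1 / r)"
        by (rule powr_mult)
      finally show "(\<Sum>k<n. (pareto N q (\<omega> k) * c k) powr r) powr (1 / r) =
          t * (\<Sum>k<n. (pareto N q (\<omega> k) * l k) powr r) powr (1 / r)"
        using t q r by (simp add: powr_powr)
    qed
    also have "\<dots> \<le> (\<Sum>\<omega>\<in>samples n N. t * (1 + (\<Sum>k<n. ?\<phi> (pareto N q (\<omega> k) * l k))))"
      using t q r l by (intro sum_mono mult_left_mono l_r_norm_le) (auto simp: pareto_def)
    also have "\<dots> = t * (real N ^ n + (\<Sum>k<n. \<Sum>\<omega>\<in>samples n N. ?\<phi> (pareto N q (\<omega> k) * l k)))"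
      unfolding sum_distrib_left[symmetric] sum.distrib
      by (subst sum.swap) (simp add: card_PiE)
    also have "\<dots> \<le> t * (real N ^ n + (\<Sum>k<n. real N ^ n * (C * l k powr q)))"
    proof (intro mult_left_mono add_left_mono sum_mono)
      fix k assume k: "k \<in> {..<n}"
      then have "n > 0" by auto
      have "(\<Sum>\<omega>\<in>samples n N. ?\<phi> (pareto N q (\<omega> k) * l k)) =
          real N ^ (n - 1) * (\<Sum>j=1..N. ?\<phi> (pareto N q j * l k))"
        using sum_PiE_marginal[of "{..<n}" k "{1..N}" "\<lambda>j. ?\<phi> (pareto N q j * l k)"] k by simp
      also have "\<dots> \<le> real N ^ (n - 1) * (C * (real N * l k powr q))"
        by (intro mult_left_mono \<phi>) auto
      also have "\<dots> = real N ^ n * (C * l k powr q)"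
        using \<open>n > 0\<close> by (cases n) auto
      finally show "(\<Sum>\<omega>\<in>samples n N. ?\<phi> (pareto N q (\<omega> k) * l k)) \<le> real N ^ n * (C * l k powr q)" .
    qed (use t in auto)
    also have "\<dots> = real N ^ n * ((1 + C) * t)"
      by (simp add: sum_distrib_left[symmetric] sum_l algebra_simps)
    finally show ?thesis by (simp add: t_def s_def)
  qed
qed

section \<open>Upper estimates imply convexity\<close>

lemma q_norm_pos_hom:
  assumes "0 < q"
  shows "(\<lambda>a. (\<Sum>k<n. \<bar>a k\<bar> powr q) powr (1 / q)) \<in> pos_hom_functions n"
  unfolding pos_hom_functions_def
proof (intro CollectI conjI allI impI)
  show "continuous_on UNIV (\<lambda>a :: nat \<Rightarrow> real. (\<Sum>k<n. \<bar>a k\<bar> powr q) powr (1 / q))"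
    using assms
    by (intro continuous_on_powr' continuous_on_sum continuous_on_rabs continuous_on_coordinate
        continuous_on_const) (auto intro: sum_nonneg)
next
  fix c :: real and a :: "nat \<Rightarrow> real"
  assume c: "0 \<le> c"
  have "(\<Sum>k<n. \<bar>c * a k\<bar> powr q) = c powr q * (\<Sum>k<n. \<bar>a k\<bar> powr q)"
    using c by (simp add: abs_mult powr_mult sum_distrib_left)
  then show "(\<Sum>k<n. \<bar>c * a k\<bar> powr q) powr (1 / q) = c * (\<Sum>k<n. \<bar>a k\<bar> powr q) powr (1 / q)"
    using assms c by (simp add: powr_mult powr_powr)
qed simp

text \<open>The constant obtained below for \<open>q > 1\<close> blows up as \<open>q\<close> tends
  to 1; at \<open>q = 1\<close> the triangle inequality suffices.\<close>

lemma q_convex_1: "q_convex TYPE('e::banach_lattice) 1"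
proof -
  have "norm (krivine n e (\<lambda>a. (\<Sum>k<n. \<bar>a k\<bar> powr 1) powr (1 / 1))) \<le>
      1 * (\<Sum>k<n. norm (e k) powr 1) powr (1 / 1)" for n and e :: "nat \<Rightarrow> 'e"
    using krivine_lattice_term[OF lattice_term_unit[of n e]] norm_sum[of "\<lambda>k. \<bar>e k\<bar>" "{..<n}"]
    by (simp add: sum_nonneg)
  then show ?thesis unfolding q_convex_def by blast
qed

lemma upper_estimate_imp_q_convex:
  fixes C q r :: real
  assumes est: "\<And>n (x :: nat \<Rightarrow> 'e::banach_lattice). 0 < n \<Longrightarrow> (\<And>k. 0 \<le> x k) \<Longrightarrow>
      norm (Sup_fin (x ` {..<n})) \<le> C * (\<Sum>k<n. norm (x k) powr r) powr (1 / r)"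
    and C: "0 \<le> C" and q: "1 < q" and r: "q < r"
  shows "q_convex TYPE('e) q"
proof -
  define D where "D = 3 * C * (1 + (1 / (1 - 1 / q) + 1 + 1 / (r / q - 1)))"
  have "norm (krivine n e (\<lambda>a. (\<Sum>k<n. \<bar>a k\<bar> powr q) powr (1 / q))) \<le>
      D * (\<Sum>k<n. norm (e k) powr q) powr (1 / q)" for n and e :: "nat \<Rightarrow> 'e"
  proof (cases "n = 0")
    case True
    then show ?thesis
      using krivine_lattice_term[OF lattice_term_zero[of n e]] by simp
  next
    case False
    then have n: "0 < n" by simp
    \<comment> \<open>The averaged bound of \<open>expectation_r_norm_le\<close> does not depend on
      \<open>N\<close>, so the smallest size allowed by \<open>q_norm_le_expectation_Max\<close> is
      taken.\<close>
    define N where "N = 2 * n"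
    have N: "0 < N" "2 * n \<le> N" using n by (auto simp: N_def)
    \<comment> \<open>Averaging over the \<open>N ^ n\<close> samples, with the 3 that compensates
      for the probability 1/3.\<close>
    define c where "c = 3 / real N ^ n"
    have c: "c \<ge> 0" by (simp add: c_def)
    define h where "h a = (\<Sum>k<n. \<bar>a k\<bar> powr q) powr (1 / q)" for a :: "nat \<Rightarrow> real"
    define g where "g a = c * (\<Sum>\<omega>\<in>samples n N. Max ((\<lambda>k. pareto N q (\<omega> k) * \<bar>a k\<bar>) ` {..<n}))"
      for a :: "nat \<Rightarrow> real"
    define y where "y \<omega> = Sup_fin ((\<lambda>k. pareto N q (\<omega> k) *\<^sub>R \<bar>e k\<bar>) ` {..<n})" for \<omega>
    have fin: "finite (samples n N)" by (intro finite_PiE) auto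
    have h: "h \<in> pos_hom_functions n"
      unfolding h_def using q by (intro q_norm_pos_hom) simp
    have g: "lattice_term n e g (c *\<^sub>R (\<Sum>\<omega>\<in>samples n N. y \<omega>))"
      unfolding g_def y_def using n
      by (intro lattice_term_scale lattice_term_sum[OF fin] lattice_term_Sup_fin lattice_term_abs
          lattice_term_coordinate) auto
    \<comment> \<open>The real inequality moves into the lattice: \<open>krivine\<close> is
      monotone, and on the lattice term \<open>g\<close> its value is the weighted sum of the joins
      \<open>y \<omega>\<close>.\<close>
    have "h a \<le> g a" for a
      using q_norm_le_expectation_Max[of q n N a] q n N
      by (simp add: h_def g_def c_def field_simps)
    then have "krivine n e h \<le> c *\<^sub>R (\<Sum>\<omega>\<in>samples n N. y \<omega>)"
      using krivine_mono[OF h lattice_term_pos_hom[OF g], of e] krivine_lattice_term[OF g] by simp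
    moreover have "0 \<le> krivine n e h"
    proof -
      have "krivine n e (\<lambda>a. 0) \<le> krivine n e h"
        by (intro krivine_mono h lattice_term_pos_hom[OF lattice_term_zero[of n e]]) (simp add: h_def)
      then show ?thesis by (simp add: krivine_lattice_term[OF lattice_term_zero])
    qed
    ultimately have "norm (krivine n e h) \<le> norm (c *\<^sub>R (\<Sum>\<omega>\<in>samples n N. y \<omega>))"
      by (intro norm_mono_nonneg)
    also have "\<dots> \<le> c * (\<Sum>\<omega>\<in>samples n N. norm (y \<omega>))"
      using c by (simp add: norm_sum mult_left_mono)
    also have "\<dots> \<le> c * (\<Sum>\<omega>\<in>samples n N.
        C * (\<Sum>k<n. (pareto N q (\<omega> k) * norm (e k)) powr r) powr (1 / r))"
    proof (intro mult_left_mono sum_mono c)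
      fix \<omega>
      show "norm (y \<omega>) \<le> C * (\<Sum>k<n. (pareto N q (\<omega> k) * norm (e k)) powr r) powr (1 / r)"
        using est[OF n, of "\<lambda>k. pareto N q (\<omega> k) *\<^sub>R \<bar>e k\<bar>"]
        by (simp add: y_def pareto_def scaleR_nonneg_nonneg)
    qed
    also have "\<dots> = c * C * (\<Sum>\<omega>\<in>samples n N.
        (\<Sum>k<n. (pareto N q (\<omega> k) * norm (e k)) powr r) powr (1 / r))"
      by (simp add: sum_distrib_left mult.assoc)
    also have "\<dots> \<le> c * C * (real N ^ n * ((1 + (1 / (1 - 1 / q) + 1 + 1 / (r / q - 1))) *
        (\<Sum>k<n. norm (e k) powr q) powr (1 / q)))"
      using c C q r N by (intro mult_left_mono expectation_r_norm_le) auto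
    also have "\<dots> = D * (\<Sum>k<n. norm (e k) powr q) powr (1 / q)"
      using N by (simp add: c_def D_def)
    finally show ?thesis unfolding h_def .
  qed
  then show ?thesis unfolding q_convex_def by blast
qed

section \<open>Integrals of step functions\<close>

lemma has_strong_integral_simple:
  assumes "Bochner_Integration.simple_bochner_integrable M f"
  shows "has_strong_integral M f (Bochner_Integration.simple_bochner_integral M f)"
  unfolding has_strong_integral_def strongly_measurable_def
  using assms by (intro conjI exI[of _ "\<lambda>_. f"]) auto

text \<open>The definite description calls for uniqueness: integrals of simple functions differ by
  at most their L1-distance, so every approximating sequence has integrals tending to that of
  \<open>f\<close>.\<close>

lemma strong_integral_simple:
  assumes f: "Bochner_Integration.simple_bochner_integrable M f"
  shows "strong_integral M f = Bochner_Integration.simple_bochner_integral M f"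
  unfolding strong_integral_def
proof (rule the_equality)
  show "has_strong_integral M f (Bochner_Integration.simple_bochner_integral M f)"
    by (rule has_strong_integral_simple[OF f])
next
  fix y assume "has_strong_integral M f y"
  then obtain s where s: "\<And>i. Bochner_Integration.simple_bochner_integrable M (s i)"
      "(\<lambda>i. \<integral>\<^sup>+x. ennreal (norm (f x - s i x)) \<partial>M) \<longlonglongrightarrow> 0"
      "(\<lambda>i. Bochner_Integration.simple_bochner_integral M (s i)) \<longlonglongrightarrow> y"
    unfolding has_strong_integral_def by blast
  let ?I = "Bochner_Integration.simple_bochner_integral M"
  have bound: "ennreal (norm (?I f - ?I (s i))) \<le> (\<integral>\<^sup>+x. ennreal (norm (f x - s i x)) \<partial>M)" for i
  proof -
    have d: "Bochner_Integration.simple_bochner_integrable M (\<lambda>x. f x - s i x)"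
      by (rule simple_bochner_integrable_compose2[OF _ f s(1)]) simp
    then have "Bochner_Integration.simple_bochner_integrable M (\<lambda>x. norm (f x - s i x))"
      by (rule simple_bochner_integrable_compose2[OF _ _ d, where p = "\<lambda>x _. norm x", rotated]) simp
    from simple_bochner_integral_eq_nn_integral[OF this]
    have "ennreal (?I (\<lambda>x. norm (f x - s i x))) = (\<integral>\<^sup>+x. ennreal (norm (f x - s i x)) \<partial>M)"
      by simp
    moreover have "norm (?I f - ?I (s i)) \<le> ?I (\<lambda>x. norm (f x - s i x))"
      using simple_bochner_integral_norm_bound[OF d] simple_bochner_integral_diff[OF f s(1), of i] by simp
    ultimately show ?thesis by (metis ennreal_leI)
  qed
  have "(\<lambda>i. ennreal (norm (?I f - ?I (s i)))) \<longlonglongrightarrow> 0"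
    by (rule tendsto_sandwich[OF _ _ tendsto_const s(2)]) (auto intro!: always_eventually bound)
  then have "(\<lambda>i. norm (?I f - ?I (s i))) \<longlonglongrightarrow> 0"
    using tendsto_ennreal_iff[of "\<lambda>i. norm (?I f - ?I (s i))" sequentially 0] by simp
  then have "(\<lambda>i. ?I f - (?I f - ?I (s i))) \<longlonglongrightarrow> ?I f - 0"
    by (intro tendsto_diff tendsto_const) (simp add: tendsto_norm_zero_iff)
  then show "y = ?I f"
    using LIMSEQ_unique[OF s(3)] by simp
qed

lemma
  fixes c :: "'b::real_normed_vector"
  assumes A: "A \<in> sets M" "emeasure M A < \<infinity>"
  shows simple_integrable_indicator:
      "Bochner_Integration.simple_bochner_integrable M (\<lambda>x. indicator A x *\<^sub>R c)" (is ?thesis1)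
    and simple_integral_indicator:
      "Bochner_Integration.simple_bochner_integral M (\<lambda>x. indicator A x *\<^sub>R c) = measure M A *\<^sub>R c" (is ?thesis2)
proof -
  have int: "Bochner_Integration.simple_bochner_integrable M (indicator A :: 'a \<Rightarrow> real)"
  proof
    show "simple_function M (indicator A :: 'a \<Rightarrow> real)" using A by simp
    have "{y \<in> space M. (indicator A y :: real) \<noteq> 0} = A"
      using sets.sets_into_space[OF A(1)] by (auto simp: indicator_def)
    then show "emeasure M {y \<in> space M. (indicator A y :: real) \<noteq> 0} \<noteq> \<infinity>" using A by simp
  qed
  show ?thesis1
    by (rule simple_bochner_integrable_compose2[OF _ int int, where p = "\<lambda>x _. x *\<^sub>R c"]) simp
  have "ennreal (Bochner_Integration.simple_bochner_integral M (indicator A :: 'a \<Rightarrow> real)) = ennreal (measure M A)"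
    using A simple_bochner_integral_eq_nn_integral[OF int]
    by (simp add: ennreal_indicator emeasure_eq_ennreal_measure)
  then have "Bochner_Integration.simple_bochner_integral M (indicator A :: 'a \<Rightarrow> real) = measure M A"
    by (subst (asm) ennreal_inj) auto
  moreover have "linear (\<lambda>t. t *\<^sub>R c)" by (intro linearI) (simp_all add: scaleR_add_left)
  ultimately show ?thesis2
    using simple_bochner_integral_linear[OF _ int, of "\<lambda>t. t *\<^sub>R c"] by simp
qed

lemma
  fixes c :: "nat \<Rightarrow> 'b::real_normed_vector"
  assumes A: "\<And>j. A j \<in> sets M" "\<And>j. emeasure M (A j) < \<infinity>"
  shows simple_integrable_step:
      "Bochner_Integration.simple_bochner_integrable M (\<lambda>x. \<Sum>j<n. indicator (A j) x *\<^sub>R c j)" (is ?thesis1)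
    and strong_integral_step:
      "strong_integral M (\<lambda>x. \<Sum>j<n. indicator (A j) x *\<^sub>R c j) = (\<Sum>j<n. measure M (A j) *\<^sub>R c j)" (is ?thesis2)
proof -
  have "Bochner_Integration.simple_bochner_integrable M (\<lambda>x. \<Sum>j<n. indicator (A j) x *\<^sub>R c j) \<and>
    Bochner_Integration.simple_bochner_integral M (\<lambda>x. \<Sum>j<n. indicator (A j) x *\<^sub>R c j) =
      (\<Sum>j<n. measure M (A j) *\<^sub>R c j)"
  proof (induction n)
    case 0
    show ?case
      using simple_integrable_indicator[of "{}" M "0::'b"] simple_integral_indicator[of "{}" M "0::'b"] by simp
  next
    case (Suc n)
    then have 1: "Bochner_Integration.simple_bochner_integrable M (\<lambda>x. \<Sum>j<n. indicator (A j) x *\<^sub>R c j)"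
      by simp
    note 2 = simple_integrable_indicator[OF A, of n "c n"]
    have "Bochner_Integration.simple_bochner_integrable M
        (\<lambda>x. (\<Sum>j<n. indicator (A j) x *\<^sub>R c j) + indicator (A n) x *\<^sub>R c n)"
      by (rule simple_bochner_integrable_compose2[OF _ 1 2]) simp
    with Suc simple_bochner_integral_add[OF 1 2] simple_integral_indicator[OF A, of n "c n"]
    show ?case by simp
  qed
  then show ?thesis1 ?thesis2 by (auto simp: strong_integral_simple)
qed

section \<open>Nested dyadic cubes\<close>

text \<open>Scale \<open>- int k\<close> means side length \<open>2 ^ k\<close>, so the cubes grow
  with \<open>k\<close>.\<close>

lemma mem_dyadic_cube_iff:
  "x \<in> dyadic_cube (- int k) m \<longleftrightarrow>
    (\<forall>i. 2 ^ k * of_int (m i) \<le> x $ i \<and> x $ i < 2 ^ k * (of_int (m i) + 1))"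
proof
  assume "x \<in> dyadic_cube (- int k) m"
  then show "\<forall>i. 2 ^ k * of_int (m i) \<le> x $ i \<and> x $ i < 2 ^ k * (of_int (m i) + 1)"
    unfolding dyadic_cube_def by auto
next
  assume x: "\<forall>i. 2 ^ k * of_int (m i) \<le> x $ i \<and> x $ i < 2 ^ k * (of_int (m i) + 1)"
  define y where "y = (1 / 2 ^ k) *\<^sub>R x - (\<chi> i. of_int (m i))"
  have "x = (2 powi (- (- int k))) *\<^sub>R (y + (\<chi> i. of_int (m i)))"
    by (simp add: y_def)
  moreover have "\<forall>i. 0 \<le> y $ i \<and> y $ i < 1"
    using x by (auto simp: y_def field_simps)
  ultimately show "x \<in> dyadic_cube (- int k) m"
    unfolding dyadic_cube_def by blast
qed

lemma dyadic_cube_borel: "dyadic_cube (- int k) m \<in> sets borel"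
proof -
  have "dyadic_cube (- int k) m = (\<Inter>i. {x. 2 ^ k * of_int (m i) \<le> x $ i} \<inter> {x. x $ i < 2 ^ k * (of_int (m i) + 1)})"
    by (auto simp: mem_dyadic_cube_iff)
  also have "\<dots> \<in> sets borel"
    by (intro sets.finite_INT sets.Int borel_closed borel_open closed_Collect_le open_Collect_less
        continuous_intros) auto
  finally show ?thesis .
qed

lemma dyadic_cube_bounded: "bounded (dyadic_cube (- int k) m :: (real ^ 'd) set)"
proof (rule bounded_subset[OF bounded_cbox])
  show "dyadic_cube (- int k) m \<subseteq> cbox (\<chi> i. 2 ^ k * of_int (m i)) (\<chi> i. 2 ^ k * (of_int (m i) + 1))"
    by (auto simp: mem_dyadic_cube_iff mem_box_cart less_imp_le)
qed

lemma emeasure_compact_finite: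
  assumes \<mu>: "locally_finite_borel_measure \<mu>" and K: "compact K"
  shows "emeasure \<mu> K < \<infinity>"
proof -
  obtain U where U: "\<And>x. open (U x)" "\<And>x. x \<in> U x" "\<And>x. emeasure \<mu> (U x) < \<infinity>"
    using \<mu> unfolding locally_finite_borel_measure_def by metis
  have sets: "sets \<mu> = sets borel" using \<mu> by (simp add: locally_finite_borel_measure_def)
  have "K \<subseteq> (\<Union>x\<in>K. U x)" using U(2) by auto
  then obtain T where T: "T \<subseteq> K" "finite T" "K \<subseteq> (\<Union>x\<in>T. U x)"
    by (rule compactE_image[OF K U(1)])
  have "emeasure \<mu> K \<le> emeasure \<mu> (\<Union>x\<in>T. U x)"
    using T U(1) by (intro emeasure_mono) (auto simp: sets)
  also have "\<dots> \<le> (\<Sum>x\<in>T. emeasure \<mu> (U x))"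
    using T U(1) by (intro emeasure_subadditive_finite) (auto simp: sets)
  also have "\<dots> < \<infinity>" using U(3) using T(2) by simp
  finally show ?thesis .
qed

text \<open>
  The dyadic cubes with corner \<open>0\<close> in one fixed orthant increase to that orthant, and one of the
  finitely many orthants has infinite measure.
\<close>

lemma exhausting_dyadic_cubes:
  fixes \<mu> :: "(real ^ 'd) measure"
  assumes \<mu>: "locally_finite_borel_measure \<mu>" and inf: "emeasure \<mu> UNIV = \<infinity>"
  obtains Q :: "nat \<Rightarrow> (real ^ 'd) set" where
    "\<And>k. Q k \<in> dyadic_cubes" "incseq Q" "\<And>k. Q k \<in> sets \<mu>" "\<And>k. emeasure \<mu> (Q k) < \<infinity>"
    "\<And>B. \<exists>k. B < measure \<mu> (Q k)"
proof -
  have sets: "sets \<mu> = sets borel" using \<mu> by (simp add: locally_finite_borel_measure_def)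
  \<comment> \<open>One pattern per orthant: an entry -1 gives the side \<open>[-2 ^ k, 0)\<close>
    and an entry 0 gives \<open>[0, 2 ^ k)\<close>, so the origin is a corner at every
    scale.\<close>
  define \<Sigma> where "\<Sigma> = {\<sigma> :: 'd \<Rightarrow> int. \<forall>i. \<sigma> i \<in> {-1, 0}}"
  have fin: "finite \<Sigma>"
    using finite_PiE[of "UNIV :: 'd set" "\<lambda>_. {-1, 0 :: int}"]
    by (simp add: \<Sigma>_def PiE_UNIV_domain Pi_def)
  let ?Q = "\<lambda>\<sigma> k. dyadic_cube (- int k) \<sigma> :: (real ^ 'd) set"
  have inc: "incseq (?Q \<sigma>)" if "\<sigma> \<in> \<Sigma>" for \<sigma>
  proof (rule incseq_SucI)
    show "?Q \<sigma> k \<subseteq> ?Q \<sigma> (Suc k)" for k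
    proof
      fix x :: "real ^ 'd" assume x: "x \<in> ?Q \<sigma> k"
      have "2 ^ Suc k * of_int (\<sigma> i) \<le> x $ i \<and> x $ i < 2 ^ Suc k * (of_int (\<sigma> i) + 1)" for i
      proof -
        have "\<sigma> i \<in> {-1, 0}" using that by (simp add: \<Sigma>_def)
        moreover have "2 ^ k * of_int (\<sigma> i) \<le> x $ i" "x $ i < 2 ^ k * (of_int (\<sigma> i) + 1)"
          using x by (auto simp: mem_dyadic_cube_iff)
        moreover have "(0::real) < 2 ^ k" by simp
        ultimately show ?thesis unfolding power_Suc by auto
      qed
      then show "x \<in> ?Q \<sigma> (Suc k)" unfolding mem_dyadic_cube_iff by blast
    qed
  qed
  have meas: "?Q \<sigma> k \<in> sets \<mu>" for \<sigma> k by (simp add: sets dyadic_cube_borel)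
  have "x \<in> (\<Union>\<sigma>\<in>\<Sigma>. \<Union>k. ?Q \<sigma> k)" for x :: "real ^ 'd"
  proof -
    define \<sigma> :: "'d \<Rightarrow> int" where "\<sigma> i = (if 0 \<le> x $ i then 0 else -1)" for i
    obtain k where k: "norm x < 2 ^ k" using real_arch_pow[of 2 "norm x"] by auto
    have "2 ^ k * of_int (\<sigma> i) \<le> x $ i \<and> x $ i < 2 ^ k * (of_int (\<sigma> i) + 1)" for i
      using component_le_norm_cart[of x i] k by (auto simp: \<sigma>_def)
    then have "x \<in> ?Q \<sigma> k" by (simp add: mem_dyadic_cube_iff)
    moreover have "\<sigma> \<in> \<Sigma>" by (simp add: \<Sigma>_def \<sigma>_def)
    ultimately show ?thesis by blast
  qed
  then have "(\<infinity>::ennreal) = emeasure \<mu> (\<Union>\<sigma>\<in>\<Sigma>. \<Union>k. ?Q \<sigma> k)"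
    using inf by (metis UNIV_eq_I)
  also have "\<dots> \<le> (\<Sum>\<sigma>\<in>\<Sigma>. emeasure \<mu> (\<Union>k. ?Q \<sigma> k))"
    using fin meas by (intro emeasure_subadditive_finite) auto
  finally obtain \<sigma> where \<sigma>: "\<sigma> \<in> \<Sigma>" "emeasure \<mu> (\<Union>k. ?Q \<sigma> k) = \<infinity>"
    using fin by (auto simp: top_unique)
  have finite: "emeasure \<mu> (?Q \<sigma> k) < \<infinity>" for k
  proof -
    \<comment> \<open>The half-open cube is not compact, but it is bounded, so its closure has
      finite measure.\<close>
    have "emeasure \<mu> (?Q \<sigma> k) \<le> emeasure \<mu> (closure (?Q \<sigma> k))"
      by (intro emeasure_mono closure_subset) (simp add: sets)
    also have "\<dots> < \<infinity>"
      using dyadic_cube_bounded by (intro emeasure_compact_finite[OF \<mu>]) (simp add: compact_closure)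
    finally show ?thesis .
  qed
  have sup: "(SUP k. emeasure \<mu> (?Q \<sigma> k)) = \<infinity>"
    using SUP_emeasure_incseq[OF _ inc[OF \<sigma>(1)], of \<mu>] meas \<sigma>(2) by auto
  have "\<exists>k. B < measure \<mu> (?Q \<sigma> k)" for B
  proof -
    have "ennreal (max B 0) < (SUP k. emeasure \<mu> (?Q \<sigma> k))" by (simp add: sup)
    then obtain k where "ennreal (max B 0) < emeasure \<mu> (?Q \<sigma> k)" by (auto simp: less_SUP_iff)
    then have "ennreal (max B 0) < ennreal (measure \<mu> (?Q \<sigma> k))"
      using finite[of k] by (simp add: emeasure_eq_ennreal_measure)
    then show ?thesis by (auto simp: ennreal_less_iff)
  qed
  then show ?thesis
    using inc[OF \<sigma>(1)] meas finite by (intro that[of "?Q \<sigma>"]) (auto simp: dyadic_cubes_def)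
qed

text \<open>A subsequence of the exhausting cubes: their measures are finite and unbounded, so the
  next index can always be chosen far enough out to gain the factor \<open>R\<close>.\<close>

lemma nested_dyadic_cubes:
  fixes \<mu> :: "(real ^ 'd) measure" and R :: real
  assumes \<mu>: "locally_finite_borel_measure \<mu>" and inf: "emeasure \<mu> UNIV = \<infinity>"
  obtains P :: "nat \<Rightarrow> (real ^ 'd) set" where
    "\<And>k. P k \<in> dyadic_cubes" "incseq P" "\<And>k. P k \<in> sets \<mu>" "\<And>k. emeasure \<mu> (P k) < \<infinity>"
    "\<And>k. 0 < measure \<mu> (P k)" "\<And>k. R * measure \<mu> (P k) \<le> measure \<mu> (P (Suc k))"
proof -
  obtain Q :: "nat \<Rightarrow> (real ^ 'd) set" where Q: "\<And>k. Q k \<in> dyadic_cubes" "incseq Q"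
      "\<And>k. Q k \<in> sets \<mu>" "\<And>k. emeasure \<mu> (Q k) < \<infinity>" "\<And>B. \<exists>k. B < measure \<mu> (Q k)"
    using exhausting_dyadic_cubes[OF \<mu> inf] by blast
  have mono: "measure \<mu> (Q k) \<le> measure \<mu> (Q l)" if "k \<le> l" for k l
    using Q(2-4) that by (intro measure_mono_fmeasurable) (auto simp: incseq_def fmeasurable_def)
  have "\<exists>K. \<forall>j. 0 < measure \<mu> (Q (K j)) \<and>
      (K j \<le> K (Suc j) \<and> R * measure \<mu> (Q (K j)) \<le> measure \<mu> (Q (K (Suc j))))"
  proof (rule dependent_nat_choice)
    show "\<exists>k. 0 < measure \<mu> (Q k)" by (rule Q(5))
    fix k and n :: nat assume k: "0 < measure \<mu> (Q k)"
    obtain l where "R * measure \<mu> (Q k) < measure \<mu> (Q l)" using Q(5) by blast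
    then show "\<exists>l. 0 < measure \<mu> (Q l) \<and> (k \<le> l \<and> R * measure \<mu> (Q k) \<le> measure \<mu> (Q l))"
      using mono[of k "max k l"] mono[of l "max k l"] k by (intro exI[of _ "max k l"]) auto
  qed
  then obtain K where K: "\<And>j. 0 < measure \<mu> (Q (K j))" "\<And>j. K j \<le> K (Suc j)"
    "\<And>j. R * measure \<mu> (Q (K j)) \<le> measure \<mu> (Q (K (Suc j)))" by blast
  show ?thesis
  proof (rule that[of "\<lambda>j. Q (K j)"])
    show "incseq (\<lambda>j. Q (K j))"
      using K(2) Q(2) by (intro incseq_SucI) (auto simp: incseq_def)
  qed (use Q K in auto)
qed

section \<open>From sparse domination to upper estimates\<close>

text \<open>The \<open>n\<close> equal perturbations have total \<open>r\<close>-th power at most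
  \<open>\<Lambda> powr r\<close>, because \<open>real n \<le> real n powr r\<close>. The 4 is a 2
  from splitting each sum times a 2 from \<open>2 \<le> 2 powr r\<close>.\<close>

lemma sum_powr_perturbed_le:
  fixes a :: "nat \<Rightarrow> real" and r :: real
  assumes a: "\<And>k. 0 \<le> a k" and r: "1 \<le> r" and n: "0 < n"
  defines "\<Lambda> \<equiv> (\<Sum>k<n. a k powr r) powr (1 / r)"
  shows "(\<Sum>k<n. (a k + \<Lambda> / real n) powr r) powr (1 / r) \<le> 4 * \<Lambda>"
proof -
  have \<Lambda>0: "0 \<le> \<Lambda>" by (simp add: \<Lambda>_def)
  have \<Lambda>: "(\<Sum>k<n. a k powr r) = \<Lambda> powr r"
    using r by (simp add: \<Lambda>_def powr_powr sum_nonneg)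
  have "(x + y) powr r \<le> 2 powr r * (x powr r + y powr r)" if "0 \<le> x" "0 \<le> y" for x y :: real
  proof -
    have "(x + y) powr r \<le> (2 * max x y) powr r"
      using that r by (intro powr_mono2) auto
    also have "\<dots> = 2 powr r * max x y powr r"
      using that by (simp add: powr_mult)
    also have "\<dots> \<le> 2 powr r * (x powr r + y powr r)"
      by (intro mult_left_mono) (auto simp: max_def)
    finally show ?thesis .
  qed
  then have "(\<Sum>k<n. (a k + \<Lambda> / real n) powr r) \<le>
      (\<Sum>k<n. 2 powr r * (a k powr r + (\<Lambda> / real n) powr r))"
    using a \<Lambda>0 by (intro sum_mono) auto
  also have "\<dots> = 2 powr r * (\<Lambda> powr r + real n * (\<Lambda> / real n) powr r)"
    by (simp add: sum_distrib_left[symmetric] sum.distrib \<Lambda>)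
  also have "\<dots> \<le> 2 powr r * (\<Lambda> powr r + \<Lambda> powr r)"
  proof (intro mult_left_mono add_left_mono)
    have "real n \<le> real n powr r"
      using powr_mono[of 1 r "real n"] r n by simp
    then show "real n * (\<Lambda> / real n) powr r \<le> \<Lambda> powr r"
      using n \<Lambda>0 mult_right_mono[of "real n" "real n powr r" "\<Lambda> powr r"]
      by (simp add: powr_divide field_simps)
  qed simp
  also have "\<dots> \<le> 2 powr r * (2 powr r * \<Lambda> powr r)"
    using powr_mono[of 1 r 2] r mult_right_mono[of 2 "2 powr r" "\<Lambda> powr r"] by simp
  also have "\<dots> = (4 * \<Lambda>) powr r"
    using \<Lambda>0 by (simp add: powr_mult[symmetric] mult.assoc[symmetric])
  finally have "(\<Sum>k<n. (a k + \<Lambda> / real n) powr r) powr (1 / r) \<le> ((4 * \<Lambda>) powr r) powr (1 / r)"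
    using r by (intro powr_mono2 sum_nonneg) auto
  also have "\<dots> = 4 * \<Lambda>" using r \<Lambda>0 by (simp add: powr_powr)
  finally show ?thesis .
qed

text \<open>
  The values \<open>y k\<close> are put on the shells between very rapidly growing nested cubes, so that the
  average of \<open>f\<close> over the cube \<open>P k\<close> is essentially \<open>y k\<close>. Both sides are then compared at a
  point of the smallest cube.
\<close>

lemma sparse_domination_imp_upper_estimate:
  fixes \<mu> :: "(real ^ 'd) measure" and r C :: real and y :: "nat \<Rightarrow> 'e::banach_lattice"
  assumes \<mu>: "locally_finite_borel_measure \<mu>" and inf: "emeasure \<mu> UNIV = \<infinity>"
    and r: "1 < r" and C: "0 \<le> C"
    and dom: "\<And>\<D> (f :: real ^ 'd \<Rightarrow> 'e). finite \<D> \<Longrightarrow> \<D> \<subseteq> dyadic_cubes \<Longrightarrow> locally_integrable \<mu> f \<Longrightarrow>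
       \<exists>\<S>\<subseteq>\<D>. AE x in \<mu>. norm (lattice_maximal \<mu> \<D> f x) \<le> C * sparse_operator \<mu> r \<S> (\<lambda>y. norm (f y)) x"
    and n: "0 < n" and y: "\<And>k. 0 \<le> y k"
  shows "norm (Sup_fin (y ` {..<n})) \<le> 8 * C * (\<Sum>k<n. norm (y k) powr r) powr (1 / r)"
proof -
  have sets: "sets \<mu> = sets borel" using \<mu> by (simp add: locally_finite_borel_measure_def)
  \<comment> \<open>With this ratio the shells inside \<open>P k\<close> of smaller index add at
    most \<open>n * \<Lambda> / R = \<Lambda> / (2 * n)\<close> to the average of the norms, and
    \<open>R \<ge> 2\<close> leaves at least half of each cube in its own shell.\<close>
  define R where "R = 2 * (real n)\<^sup>2"
  have R: "2 \<le> R" using n by (simp add: R_def)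
  obtain P :: "nat \<Rightarrow> (real ^ 'd) set" where P: "\<And>k. P k \<in> dyadic_cubes" "incseq P"
      "\<And>k. P k \<in> sets \<mu>" "\<And>k. emeasure \<mu> (P k) < \<infinity>" "\<And>k. 0 < measure \<mu> (P k)"
      "\<And>k. R * measure \<mu> (P k) \<le> measure \<mu> (P (Suc k))"
    using nested_dyadic_cubes[OF \<mu> inf, of R] by blast
  have P_mono: "P j \<subseteq> P k" if "j \<le> k" for j k using P(2) that by (auto simp: incseq_def)
  have P_fm: "P k \<in> fmeasurable \<mu>" for k using P(3,4) by (simp add: fmeasurable_def)
  have mono: "measure \<mu> (P j) \<le> measure \<mu> (P k)" if "j \<le> k" for j k
    using P_mono[OF that] P(3) P_fm by (intro measure_mono_fmeasurable)
  define A where "A j = (case j of 0 \<Rightarrow> P 0 | Suc i \<Rightarrow> P (Suc i) - P i)" for j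
  have A_sub: "A j \<subseteq> P j" for j by (auto simp: A_def split: nat.split)
  have A_sets: "A j \<in> sets \<mu>" for j using P(3) by (auto simp: A_def split: nat.split)
  have A_fin: "emeasure \<mu> (A j) < \<infinity>" for j
    using emeasure_mono[OF A_sub P(3), of j] P(4)[of j] by (rule le_less_trans)
  have A_le: "measure \<mu> (A j) \<le> measure \<mu> (P j)" for j
    by (rule measure_mono_fmeasurable[OF A_sub A_sets P_fm])
  have A_ge: "measure \<mu> (P j) / 2 \<le> measure \<mu> (A j)" for j
  proof (cases j)
    case 0
    then show ?thesis by (simp add: A_def measure_nonneg)
  next
    case (Suc i)
    have "measure \<mu> (A j) = measure \<mu> (P j) - measure \<mu> (P i)"
      unfolding Suc A_def using P_mono[of i "Suc i"] P_fm P(4)[of "Suc i"] P(3)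
      by (simp add: measure_Diff less_top)
    moreover have "2 * measure \<mu> (P i) \<le> measure \<mu> (P j)"
      using P(6)[of i] mult_right_mono[OF R, of "measure \<mu> (P i)"] by (simp add: Suc)
    ultimately show ?thesis by simp
  qed
  have A_disj: "A i \<inter> P j = {}" if "j < i" for i j
    using that P_mono[of j "i - 1"] by (auto simp: A_def split: nat.split)
  define f where "f x = (\<Sum>j<n. indicator (A j) x *\<^sub>R y j)" for x
  have f_on_A: "f x = y j" if "x \<in> A j" "j < n" for x j
  proof -
    have "indicator (A i) x *\<^sub>R y i = (if i = j then y j else 0)" for i
      using that(1) A_disj[of i j] A_disj[of j i] A_sub
      by (cases i j rule: linorder_cases) (auto simp: indicator_def)
    then show ?thesis using that(2) by (simp add: f_def)
  qed
  have f_off: "f x = 0" if "\<And>j. j < n \<Longrightarrow> x \<notin> A j" for x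
    using that by (simp add: f_def)
  have f_abs: "\<bar>f x\<bar> = f x" for x
    unfolding f_def by (intro abs_of_nonneg sum_nonneg scaleR_nonneg_nonneg y) simp
  have f_norm: "norm (f x) = (\<Sum>j<n. indicator (A j) x *\<^sub>R norm (y j))" for x
  proof (cases "\<exists>j<n. x \<in> A j")
    case True
    then obtain j where j: "j < n" "x \<in> A j" by blast
    have "indicator (A i) x *\<^sub>R norm (y i) = (if i = j then norm (y j) else 0)" for i
      using j(2) A_disj[of i j] A_disj[of j i] A_sub
      by (cases i j rule: linorder_cases) (auto simp: indicator_def)
    then show ?thesis using j f_on_A[OF j(2,1)] by simp
  next
    case False
    then show ?thesis using f_off[of x] by auto
  qed
  \<comment> \<open>Restriction to \<open>P k\<close> removes exactly the shells of index above
    \<open>k\<close>.\<close>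
  have ind: "indicator (P k) x * indicator (A j) x = (if j \<le> k then indicator (A j) x else 0 :: real)" for k j x
    using A_disj[of k j] A_sub[of j] P_mono[of j k] by (auto simp: indicator_def)
  have avg: "average \<mu> (P k) (\<lambda>x. \<Sum>j<n. indicator (A j) x *\<^sub>R c j) =
      (1 / measure \<mu> (P k)) *\<^sub>R (\<Sum>j<n. if j \<le> k then measure \<mu> (A j) *\<^sub>R c j else 0)"
    for k and c :: "nat \<Rightarrow> 'b::real_normed_vector"
  proof -
    have "(\<lambda>x. indicator (P k) x *\<^sub>R (\<Sum>j<n. indicator (A j) x *\<^sub>R c j)) =
        (\<lambda>x. \<Sum>j<n. indicator (A j) x *\<^sub>R (if j \<le> k then c j else 0))"
    proof
      fix x
      have "indicator (P k) x *\<^sub>R (\<Sum>j<n. indicator (A j) x *\<^sub>R c j) =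
          (\<Sum>j<n. (indicator (P k) x * indicator (A j) x) *\<^sub>R c j)"
        by (simp only: scaleR_sum_right scaleR_scaleR)
      also have "\<dots> = (\<Sum>j<n. indicator (A j) x *\<^sub>R (if j \<le> k then c j else 0))"
        unfolding ind by (intro sum.cong) auto
      finally show "indicator (P k) x *\<^sub>R (\<Sum>j<n. indicator (A j) x *\<^sub>R c j) = \<dots>" .
    qed
    then have "average \<mu> (P k) (\<lambda>x. \<Sum>j<n. indicator (A j) x *\<^sub>R c j) =
        (1 / measure \<mu> (P k)) *\<^sub>R (\<Sum>j<n. measure \<mu> (A j) *\<^sub>R (if j \<le> k then c j else 0))"
      unfolding average_def by (simp only: strong_integral_step[OF A_sets A_fin])
    also have "(\<Sum>j<n. measure \<mu> (A j) *\<^sub>R (if j \<le> k then c j else 0)) =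
        (\<Sum>j<n. if j \<le> k then measure \<mu> (A j) *\<^sub>R c j else 0)"
      by (intro sum.cong) auto
    finally show ?thesis .
  qed
  have avg_f: "(1 / 2) *\<^sub>R y k \<le> average \<mu> (P k) (\<lambda>x. \<bar>f x\<bar>)" if k: "k < n" for k
  proof -
    \<comment> \<open>All summands are nonnegative, so only shell \<open>k\<close> is kept; it fills
      at least half of \<open>P k\<close>.\<close>
    have "measure \<mu> (A k) *\<^sub>R y k \<le> (\<Sum>j<n. if j \<le> k then measure \<mu> (A j) *\<^sub>R y j else 0)"
    proof -
      have "0 \<le> (\<Sum>j\<in>{..<n} - {k}. if j \<le> k then measure \<mu> (A j) *\<^sub>R y j else 0)"
        using y by (intro sum_nonneg) (auto intro: scaleR_nonneg_nonneg)
      then show ?thesis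
        using k by (subst sum.remove[of _ k]) auto
    qed
    then have "(1 / measure \<mu> (P k)) *\<^sub>R (measure \<mu> (A k) *\<^sub>R y k) \<le> average \<mu> (P k) (\<lambda>x. \<bar>f x\<bar>)"
      unfolding f_abs unfolding f_def avg by (intro scaleR_left_mono) auto
    moreover have "(1 / 2) *\<^sub>R y k \<le> (measure \<mu> (A k) / measure \<mu> (P k)) *\<^sub>R y k"
      using A_ge[of k] P(5)[of k] by (intro scaleR_right_mono y) (simp add: field_simps)
    ultimately show ?thesis by simp
  qed
  define \<Lambda> where "\<Lambda> = (\<Sum>k<n. norm (y k) powr r) powr (1 / r)"
  have y_le: "norm (y k) \<le> \<Lambda>" if "k < n" for k
  proof -
    have "(norm (y k) powr r) powr (1 / r) \<le> \<Lambda>"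
      unfolding \<Lambda>_def using r that
      by (intro powr_mono2 member_le_sum[of k "{..<n}" "\<lambda>k. norm (y k) powr r"]) auto
    then show ?thesis using r by (simp add: powr_powr)
  qed
  have avg_norm: "0 \<le> average \<mu> (P k) (\<lambda>x. \<bar>norm (f x)\<bar>)"
      "average \<mu> (P k) (\<lambda>x. \<bar>norm (f x)\<bar>) \<le> norm (y k) + \<Lambda> / real n" if k: "k < n" for k
  proof -
    let ?m = "measure \<mu> (P k)"
    have eq: "average \<mu> (P k) (\<lambda>x. \<bar>norm (f x)\<bar>) =
        (\<Sum>j<n. if j \<le> k then measure \<mu> (A j) * norm (y j) else 0) / ?m"
      unfolding abs_norm_cancel unfolding f_norm avg by (simp cong: if_cong)
    show "0 \<le> average \<mu> (P k) (\<lambda>x. \<bar>norm (f x)\<bar>)"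
      unfolding eq by (intro divide_nonneg_nonneg sum_nonneg) auto
    \<comment> \<open>Shell \<open>k\<close> carries the main term; the allowance
      \<open>\<Lambda> / R\<close> pays for each smaller shell, whose measure is at most
      \<open>?m / R\<close>.\<close>
    have "(if j \<le> k then measure \<mu> (A j) * norm (y j) else 0) \<le>
        ?m * ((if j = k then norm (y k) else 0) + \<Lambda> / R)" if j: "j < n" for j
    proof -
      have \<Lambda>R: "0 \<le> \<Lambda> / R" using R by (simp add: \<Lambda>_def)
      consider "j < k" | "j = k" | "k < j" by linarith
      then show ?thesis
      proof cases
        case 1
        have "R * measure \<mu> (P j) \<le> ?m" using P(6)[of j] mono[of "Suc j" k] 1 by simp
        with A_le[of j] R have "measure \<mu> (A j) \<le> ?m / R"
          by (simp add: pos_le_divide_eq mult.commute order_trans[OF mult_left_mono])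
        then have "measure \<mu> (A j) * norm (y j) \<le> ?m / R * \<Lambda>"
          using y_le[OF j] R by (intro mult_mono) auto
        then show ?thesis using 1 by simp
      next
        case 2
        then show ?thesis
          using mult_right_mono[OF A_le[of k], of "norm (y k)"] mult_nonneg_nonneg[OF _ \<Lambda>R, of ?m]
          by (simp add: distrib_left)
      next
        case 3
        then show ?thesis using mult_nonneg_nonneg[OF _ \<Lambda>R, of ?m] by simp
      qed
    qed
    then have "(\<Sum>j<n. if j \<le> k then measure \<mu> (A j) * norm (y j) else 0) \<le>
        (\<Sum>j<n. ?m * ((if j = k then norm (y k) else 0) + \<Lambda> / R))"
      by (intro sum_mono) simp
    also have "\<dots> = ?m * (norm (y k) + real n * (\<Lambda> / R))"
      using k by (simp add: sum_distrib_left[symmetric] sum.distrib)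
    also have "\<dots> \<le> ?m * (norm (y k) + \<Lambda> / real n)"
    proof (intro mult_left_mono add_left_mono)
      have half: "t / 2 \<le> t" if "0 \<le> t" for t :: real
        using that by simp
      have "real n * (\<Lambda> / R) = \<Lambda> / real n / 2"
        using n by (simp add: R_def power2_eq_square)
      also have "\<dots> \<le> \<Lambda> / real n"
        by (rule half) (simp add: \<Lambda>_def)
      finally show "real n * (\<Lambda> / R) \<le> \<Lambda> / real n" .
    qed simp
    finally show "average \<mu> (P k) (\<lambda>x. \<bar>norm (f x)\<bar>) \<le> norm (y k) + \<Lambda> / real n"
      unfolding eq using P(5)[of k] by (simp add: pos_divide_le_eq mult.commute)
  qed
  have "locally_integrable \<mu> f"
    unfolding locally_integrable_def
  proof (intro allI impI)
    fix K :: "(real ^ 'd) set" assume "compact K"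
    then have K: "K \<in> sets \<mu>" by (simp add: sets compact_imp_closed)
    have "(\<lambda>x. indicator K x *\<^sub>R f x) = (\<lambda>x. \<Sum>j<n. indicator (K \<inter> A j) x *\<^sub>R y j)"
      unfolding f_def by (simp only: scaleR_sum_right scaleR_scaleR indicator_inter_arith)
    moreover have "emeasure \<mu> (K \<inter> A j) < \<infinity>" for j
      using emeasure_mono[of "K \<inter> A j" "A j" \<mu>] A_sets A_fin[of j] by (auto intro: le_less_trans)
    then have "Bochner_Integration.simple_bochner_integrable \<mu> (\<lambda>x. \<Sum>j<n. indicator (K \<inter> A j) x *\<^sub>R y j)"
      using K A_sets by (intro simple_integrable_step) auto
    ultimately show "strongly_integrable \<mu> (\<lambda>x. indicator K x *\<^sub>R f x)"
      unfolding strongly_integrable_def using has_strong_integral_simple by metis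
  qed
  then obtain \<S> where \<S>: "\<S> \<subseteq> P ` {..<n}" and
    ae: "AE x in \<mu>. norm (lattice_maximal \<mu> (P ` {..<n}) f x) \<le> C * sparse_operator \<mu> r \<S> (\<lambda>y. norm (f y)) x"
    using dom[of "P ` {..<n}" f] P(1) by blast
  \<comment> \<open>\<open>P 0\<close> has positive measure, so the almost-everywhere bound holds at
    one of its points. That point lies in every \<open>P k\<close>, where all the indicators are
    1.\<close>
  have "\<exists>x\<in>P 0. norm (lattice_maximal \<mu> (P ` {..<n}) f x) \<le> C * sparse_operator \<mu> r \<S> (\<lambda>y. norm (f y)) x"
  proof (rule ccontr)
    assume "\<not> ?thesis"
    with ae have "AE x in \<mu>. x \<notin> P 0" by (auto elim!: eventually_mono)
    then have "P 0 \<in> null_sets \<mu>" using AE_iff_null_sets[OF P(3)] by blast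
    then show False using P(5)[of 0] by (simp add: measure_eq_0_null_sets)
  qed
  then obtain x where x: "x \<in> P 0" and
    le: "norm (lattice_maximal \<mu> (P ` {..<n}) f x) \<le> C * sparse_operator \<mu> r \<S> (\<lambda>y. norm (f y)) x" by blast
  have xP: "x \<in> P k" for k using x P_mono[of 0 k] by auto
  have "y k \<le> 2 *\<^sub>R lattice_maximal \<mu> (P ` {..<n}) f x" if k: "k < n" for k
  proof -
    let ?g = "\<lambda>Q. indicator Q x *\<^sub>R average \<mu> Q (\<lambda>y. \<bar>f y\<bar>)"
    have "?g (P k) \<le> Sup_fin (?g ` P ` {..<n})"
      using k by (intro Sup_fin.coboundedI) auto
    moreover have "(1 / 2) *\<^sub>R y k \<le> ?g (P k)" using avg_f[OF k] xP[of k] by simp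
    moreover have "Sup_fin (?g ` P ` {..<n}) = lattice_maximal \<mu> (P ` {..<n}) f x"
      using n by (simp add: lattice_maximal_def lessThan_empty_iff)
    ultimately have "(1 / 2) *\<^sub>R y k \<le> lattice_maximal \<mu> (P ` {..<n}) f x" by simp
    from scaleR_left_mono[OF this, of 2] show ?thesis by simp
  qed
  then have "Sup_fin (y ` {..<n}) \<le> 2 *\<^sub>R lattice_maximal \<mu> (P ` {..<n}) f x"
    using n by (intro Sup_fin.boundedI) (auto simp: lessThan_empty_iff)
  moreover have "0 \<le> Sup_fin (y ` {..<n})"
    using n by (intro order_trans[OF y[of 0]] Sup_fin.coboundedI) auto
  ultimately have "norm (Sup_fin (y ` {..<n})) \<le> norm (2 *\<^sub>R lattice_maximal \<mu> (P ` {..<n}) f x)"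
    by (intro norm_mono_nonneg)
  also have "\<dots> \<le> 2 * (C * sparse_operator \<mu> r \<S> (\<lambda>y. norm (f y)) x)" using le by simp
  also have "sparse_operator \<mu> r \<S> (\<lambda>y. norm (f y)) x \<le> 4 * \<Lambda>"
  proof -
    let ?h = "\<lambda>S. average \<mu> S (\<lambda>y. \<bar>norm (f y)\<bar>) powr r * indicator S x"
    \<comment> \<open>The terms are nonnegative, so the sum may be extended to the whole family of
      cubes.\<close>
    have "(\<Sum>S\<in>\<S>. ?h S) \<le> (\<Sum>S\<in>P ` {..<n}. ?h S)"
      using \<S> by (intro sum_mono2) auto
    also have "\<dots> \<le> (\<Sum>k<n. ?h (P k))"
      using sum_image_le[of "{..<n}" ?h P] by simp
    also have "\<dots> \<le> (\<Sum>k<n. (norm (y k) + \<Lambda> / real n) powr r)"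
      using avg_norm xP r by (intro sum_mono) (auto intro!: powr_mono2)
    finally have "sparse_operator \<mu> r \<S> (\<lambda>y. norm (f y)) x \<le>
        (\<Sum>k<n. (norm (y k) + \<Lambda> / real n) powr r) powr (1 / r)"
      unfolding sparse_operator_def using r by (intro powr_mono2 sum_nonneg) auto
    also have "\<dots> \<le> 4 * \<Lambda>"
      unfolding \<Lambda>_def using r n by (intro sum_powr_perturbed_le) auto
    finally show ?thesis .
  qed
  \<comment> \<open>The 8 is the 2 lost in \<open>avg_f\<close> times the 4 of
    \<open>sum_powr_perturbed_le\<close>.\<close>
  finally show ?thesis using C by (simp add: \<Lambda>_def mult_left_mono)
qed

theorem theorem1p2:
  fixes \<mu> :: "(real ^ 'd) measure" and r :: real
  assumes "locally_finite_borel_measure \<mu>"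
    and "emeasure \<mu> UNIV = \<infinity>"
    and "1 < r"
    and "\<exists>C. \<forall>\<D>. finite \<D> \<and> \<D> \<subseteq> dyadic_cubes \<longrightarrow>
           (\<forall>f :: real ^ 'd \<Rightarrow> 'e::banach_lattice. locally_integrable \<mu> f \<longrightarrow>
             (\<exists>\<S>. \<S> \<subseteq> \<D> \<and> sparse_collection \<mu> \<S> \<and>
               (AE x in \<mu>. norm (lattice_maximal \<mu> \<D> f x)
                  \<le> C * sparse_operator \<mu> r \<S> (\<lambda>y. norm (f y)) x)))"
  shows "\<forall>q. 1 \<le> q \<and> q < r \<longrightarrow> q_convex TYPE('e) q"
proof (intro allI impI)
  fix q assume q: "1 \<le> q \<and> q < r"
  from assms(4) obtain C where C: "\<forall>\<D>. finite \<D> \<and> \<D> \<subseteq> dyadic_cubes \<longrightarrow>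
      (\<forall>f :: real ^ 'd \<Rightarrow> 'e. locally_integrable \<mu> f \<longrightarrow> (\<exists>\<S>. \<S> \<subseteq> \<D> \<and> sparse_collection \<mu> \<S> \<and>
        (AE x in \<mu>. norm (lattice_maximal \<mu> \<D> f x) \<le> C * sparse_operator \<mu> r \<S> (\<lambda>y. norm (f y)) x)))"
    by (rule exE)
  \<comment> \<open>The given constant may be negative. The sparse operator is nonnegative, so the
    bound persists with \<open>max C 0\<close>, which has the sign required by the upper
    estimate.\<close>
  have dom: "\<exists>\<S>\<subseteq>\<D>. AE x in \<mu>. norm (lattice_maximal \<mu> \<D> f x) \<le> max C 0 * sparse_operator \<mu> r \<S> (\<lambda>y. norm (f y)) x"
    if D: "finite \<D>" "\<D> \<subseteq> dyadic_cubes" "locally_integrable \<mu> f" for \<D> and f :: "real ^ 'd \<Rightarrow> 'e"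
  proof -
    obtain \<S> where "\<S> \<subseteq> \<D>" and
      ae: "AE x in \<mu>. norm (lattice_maximal \<mu> \<D> f x) \<le> C * sparse_operator \<mu> r \<S> (\<lambda>y. norm (f y)) x"
      using C[rule_format, OF conjI[OF D(1,2)] D(3)] by (elim exE conjE)
    moreover have "AE x in \<mu>. norm (lattice_maximal \<mu> \<D> f x) \<le> max C 0 * sparse_operator \<mu> r \<S> (\<lambda>y. norm (f y)) x"
      using ae
    proof eventually_elim
      case (elim x)
      also have "C * sparse_operator \<mu> r \<S> (\<lambda>y. norm (f y)) x \<le> max C 0 * sparse_operator \<mu> r \<S> (\<lambda>y. norm (f y)) x"
        by (intro mult_right_mono) (auto simp: sparse_operator_def)
      finally show ?case .
    qed
    ultimately show ?thesis by blast
  qed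
  show "q_convex TYPE('e) q"
  proof (cases "q = 1")
    case True
    then show ?thesis using q_convex_1 by simp
  next
    case False
    with q have q: "1 < q" "q < r" by auto
    show ?thesis
    proof (rule upper_estimate_imp_q_convex[OF _ _ q])
      show "norm (Sup_fin (x ` {..<n})) \<le> (8 * max C 0) * (\<Sum>k<n. norm (x k) powr r) powr (1 / r)"
        if "0 < n" "\<And>k. 0 \<le> x k" for n and x :: "nat \<Rightarrow> 'e"
        by (rule sparse_domination_imp_upper_estimate[OF assms(1-3) _ dom that]) auto
    qed simp
  qed
qed

end
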